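(* A finite abelian group $G$ is an $\mathrm{NCI}^{(2)}$-group if and only if every Sylow subgroup of $G$ is an $\mathrm{NCI}^{(2)}$-group.
   Context: Let $G$ be a finite group and $\mathrm{Sym}(G)$ the group of all permutations of the set $G$. Let $G_r\leq \mathrm{Sym}(G)$ be the group of all right translations $x\mapsto xg$, $g\in G$, and let $\mathrm{Hol}(G)=N_{\mathrm{Sym}(G)}(G_r)=G_r\rtimes \mathrm{Aut}(G)$. For $K\leq \mathrm{Sym}(G)$, the 2-closure $K^{(2)}$ is the largest subgroup of $\mathrm{Sym}(G)$ having the same orbits on $G\times G$ (under componentwise action) as $K$; $K$ is 2-closed if $K^{(2)}=K$. A subgroup of $\mathrm{Sym}(G)$ is $G$-regular if it is regular on $G$ and isomorphic to $G$. A group $K$ with $G_r\leq K\leq \mathrm{Sym}(G)$ is $G$-transjugate if every $G$-regular subgroup of $K$ is conjugate in $K$ to $G_r$. The group $G$ is an $\mathrm{NCI}^{(2)}$-group if every 2-closed group $K$ with $G_r\leq K\leq \mathrm{Hol}(G)$ is $G$-transjugate. *)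

theory Defs
  imports "HOL-Algebra.Algebra"
begin

text \<open>
  The symmetric group of a set \<open>S\<close> is \<open>BijGroup S\<close>. Its elements are extensional functions and
  its product is composition from right to left. Hence \<open>g \<mapsto> (x \<mapsto> x \<otimes> g)\<close> is an
  anti-homomorphism for this product. None of the notions below (subgroups, orbits, regularity,
  normalizers, conjugacy, isomorphism type) depends on the side on which permutations are composed.
\<close>

abbreviation perm_group :: "'a set \<Rightarrow> ('a \<Rightarrow> 'a) set \<Rightarrow> ('a \<Rightarrow> 'a) monoid" where
  "perm_group S K \<equiv> BijGroup S\<lparr>carrier := K\<rparr>"

definition pair_orbits :: "'a set \<Rightarrow> ('a \<Rightarrow> 'a) set \<Rightarrow> ('a \<times> 'a) set set" where
  "pair_orbits S K = orbits (perm_group S K) (S \<times> S) (\<lambda>f (x, y). (f x, f y))"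

definition two_closure :: "'a set \<Rightarrow> ('a \<Rightarrow> 'a) set \<Rightarrow> ('a \<Rightarrow> 'a) set" where
  "two_closure S K =
     (GREATEST L. subgroup L (BijGroup S) \<and> pair_orbits S L = pair_orbits S K)"

definition two_closed :: "'a set \<Rightarrow> ('a \<Rightarrow> 'a) set \<Rightarrow> bool" where
  "two_closed S K \<longleftrightarrow> two_closure S K = K"

definition regular_on :: "'a set \<Rightarrow> ('a \<Rightarrow> 'a) set \<Rightarrow> bool" where
  "regular_on S H \<longleftrightarrow>
     transitive_action (perm_group S H) S (\<lambda>f. f) \<and>
     (\<forall>x\<in>S. stabilizer (perm_group S H) (\<lambda>f. f) x = {\<one>\<^bsub>BijGroup S\<^esub>})"

definition conjugate_in :: "('g, 'b) monoid_scheme \<Rightarrow> 'g set \<Rightarrow> 'g set \<Rightarrow> 'g set \<Rightarrow> bool" where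
  "conjugate_in \<Gamma> K H H' \<longleftrightarrow> (\<exists>k\<in>K. k <#\<^bsub>\<Gamma>\<^esub> H #>\<^bsub>\<Gamma>\<^esub> inv\<^bsub>\<Gamma>\<^esub> k = H')"

definition right_translations :: "('a, 'b) monoid_scheme \<Rightarrow> ('a \<Rightarrow> 'a) set" where
  "right_translations G = (\<lambda>g. \<lambda>x\<in>carrier G. x \<otimes>\<^bsub>G\<^esub> g) ` carrier G"

definition holomorph :: "('a, 'b) monoid_scheme \<Rightarrow> ('a \<Rightarrow> 'a) set" where
  "holomorph G = normalizer (BijGroup (carrier G)) (right_translations G)"

definition G_regular :: "('a, 'b) monoid_scheme \<Rightarrow> ('a \<Rightarrow> 'a) set \<Rightarrow> bool" where
  "G_regular G H \<longleftrightarrow>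
     subgroup H (BijGroup (carrier G)) \<and>
     regular_on (carrier G) H \<and>
     perm_group (carrier G) H \<cong> G"

definition G_transjugate :: "('a, 'b) monoid_scheme \<Rightarrow> ('a \<Rightarrow> 'a) set \<Rightarrow> bool" where
  "G_transjugate G K \<longleftrightarrow>
     (\<forall>H. G_regular G H \<and> H \<subseteq> K \<longrightarrow>
          conjugate_in (BijGroup (carrier G)) K H (right_translations G))"

definition NCI2_group :: "('a, 'b) monoid_scheme \<Rightarrow> bool" where
  "NCI2_group G \<longleftrightarrow>
     (\<forall>K. subgroup K (BijGroup (carrier G)) \<and> two_closed (carrier G) K \<and>
          right_translations G \<subseteq> K \<and> K \<subseteq> holomorph G \<longrightarrow> G_transjugate G K)"

text \<open>If \<open>p\<close> does not divide the order of \<open>G\<close>, the Sylow \<open>p\<close>-subgroup is trivial.\<close>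

definition sylow_subgroup :: "nat \<Rightarrow> 'a set \<Rightarrow> ('a, 'b) monoid_scheme \<Rightarrow> bool" where
  "sylow_subgroup p P G \<longleftrightarrow>
     Factorial_Ring.prime p \<and> subgroup P G \<and> card P = p ^ multiplicity p (order G)"

text \<open>
  The largest subgroup in the definition of \<open>two_closure\<close> exists, so that the \<open>GREATEST\<close>
  operator denotes it:
\<close>

lemma pair_orbits_eq_iff:
  assumes K: "subgroup K (BijGroup S)" and L: "subgroup L (BijGroup S)"
  shows "pair_orbits S L = pair_orbits S K \<longleftrightarrow>
    (\<forall>x\<in>S. \<forall>y\<in>S. {(f x, f y) | f. f \<in> L} = {(f x, f y) | f. f \<in> K})" (is "?A \<longleftrightarrow> ?B")
proof -
  define O1 where "O1 M z = {(f (fst z), f (snd z)) | f. f \<in> M}"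
    for M :: "('a \<Rightarrow> 'a) set" and z :: "'a \<times> 'a"
  have po: "pair_orbits S M = O1 M ` (S \<times> S)" for M
    by (auto simp: pair_orbits_def orbits_def orbit_def O1_def image_def case_prod_unfold)
  have self: "z \<in> O1 M z" if M: "subgroup M (BijGroup S)" and z: "z \<in> S \<times> S" for M z
  proof -
    have "(\<lambda>x\<in>S. x) \<in> M" using subgroup.one_closed[OF M] by (simp add: BijGroup_def)
    moreover have "z = ((\<lambda>x\<in>S. x) (fst z), (\<lambda>x\<in>S. x) (snd z))" using z by auto
    ultimately show ?thesis unfolding O1_def by blast
  qed
  have cls: "O1 M z = O1 M w"
    if M: "subgroup M (BijGroup S)" and z: "z \<in> S \<times> S" and w: "w \<in> O1 M z" for M z w
  proof -
    obtain f where f: "f \<in> M" "w = (f (fst z), f (snd z))" using w by (auto simp: O1_def)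
    have MB: "M \<subseteq> Bij S" using subgroup.subset[OF M] by (simp add: BijGroup_def)
    have comp: "compose S g h \<in> M" if "g \<in> M" "h \<in> M" for g h
      using subgroup.m_closed[OF M that] that subsetD[OF MB] by (simp add: BijGroup_def)
    have invM: "restrict (inv_into S f) S \<in> M"
      using subgroup.m_inv_closed[OF M f(1)] inv_BijGroup f(1) MB by fastforce
    have bij: "bij_betw f S S" using f(1) MB by (auto simp: Bij_def)
    have wS: "f (fst z) \<in> S" "f (snd z) \<in> S"
      using z bij by (auto simp: bij_betw_def)
    have inj: "inj_on f S" using bij by (simp add: bij_betw_def)
    have "O1 M z \<subseteq> O1 M w"
    proof
      fix v assume "v \<in> O1 M z"
      then obtain g where g: "g \<in> M" "v = (g (fst z), g (snd z))" by (auto simp: O1_def)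
      have "compose S g (restrict (inv_into S f) S) \<in> M" using comp[OF g(1) invM] .
      moreover have "v = (compose S g (restrict (inv_into S f) S) (fst w),
                          compose S g (restrict (inv_into S f) S) (snd w))"
        using wS z f(2) g(2) inj by (auto simp: compose_def)
      ultimately show "v \<in> O1 M w" unfolding O1_def by blast
    qed
    moreover have "O1 M w \<subseteq> O1 M z"
    proof
      fix v assume "v \<in> O1 M w"
      then obtain g where g: "g \<in> M" "v = (g (fst w), g (snd w))" by (auto simp: O1_def)
      have "v = (compose S g f (fst z), compose S g f (snd z))"
        using z f(2) g(2) by (auto simp: compose_def)
      then show "v \<in> O1 M z" using comp[OF g(1) f(1)] unfolding O1_def by blast
    qed
    ultimately show ?thesis by blast
  qed
  have "?A \<longleftrightarrow> (\<forall>z\<in>S \<times> S. O1 L z = O1 K z)"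
  proof
    assume A: ?A
    show "\<forall>z\<in>S \<times> S. O1 L z = O1 K z"
    proof
      fix z assume z: "z \<in> S \<times> S"
      then have "O1 L z \<in> O1 K ` (S \<times> S)" using A by (auto simp: po)
      then obtain w where w: "w \<in> S \<times> S" "O1 L z = O1 K w" by blast
      then have "z \<in> O1 K w" using self[OF L z] by simp
      then show "O1 L z = O1 K z" using cls[OF K w(1)] w(2) by simp
    qed
  next
    assume "\<forall>z\<in>S \<times> S. O1 L z = O1 K z"
    then show ?A unfolding po by (intro image_cong) auto
  qed
  also have "\<dots> \<longleftrightarrow> ?B" by (simp add: O1_def)
  finally show ?thesis .
qed

lemma two_closure_eq:
  assumes K: "subgroup K (BijGroup S)"
  shows "subgroup (two_closure S K) (BijGroup S)"
    and "pair_orbits S (two_closure S K) = pair_orbits S K"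
    and "\<And>L. subgroup L (BijGroup S) \<Longrightarrow> pair_orbits S L = pair_orbits S K
           \<Longrightarrow> L \<subseteq> two_closure S K"
    and "two_closure S K = {f \<in> Bij S. \<forall>x\<in>S. \<forall>y\<in>S. \<exists>k\<in>K. f x = k x \<and> f y = k y}"
proof -
  define C where "C = {f \<in> Bij S. \<forall>x\<in>S. \<forall>y\<in>S. \<exists>k\<in>K. f x = k x \<and> f y = k y}"
  have KB: "K \<subseteq> Bij S" using subgroup.subset[OF K] by (simp add: BijGroup_def)
  have comp: "compose S g h \<in> K" if "g \<in> K" "h \<in> K" for g h
    using subgroup.m_closed[OF K that] that subsetD[OF KB] by (simp add: BijGroup_def)
  have invK: "restrict (inv_into S f) S \<in> K" if "f \<in> K" for f
    using subgroup.m_inv_closed[OF K that] inv_BijGroup that KB by fastforce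
  have KC: "K \<subseteq> C" using KB by (auto simp: C_def)
  have Csub: "subgroup C (BijGroup S)"
  proof (rule group.subgroupI[OF group_BijGroup])
    show "C \<subseteq> carrier (BijGroup S)" by (auto simp: C_def BijGroup_def)
    show "C \<noteq> {}" using KC subgroup.one_closed[OF K] by blast
  next
    fix f assume f: "f \<in> C"
    then have fB: "f \<in> Bij S" by (simp add: C_def)
    have "\<exists>k\<in>K. inv_into S f x = k x \<and> inv_into S f y = k y" if xy: "x \<in> S" "y \<in> S" for x y
    proof -
      let ?u = "inv_into S f x" and ?v = "inv_into S f y"
      have uv: "?u \<in> S" "?v \<in> S" using Bij_inv_into_mem[OF fB] xy by auto
      have fuv: "f ?u = x" "f ?v = y"
        using fB xy by (auto simp: Bij_def bij_betw_def f_inv_into_f)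
      obtain k where k: "k \<in> K" "f ?u = k ?u" "f ?v = k ?v"
        using f uv by (auto simp: C_def)
      have inj: "inj_on k S" using k(1) KB by (auto simp: Bij_def bij_betw_def)
      have "inv_into S k x = ?u" "inv_into S k y = ?v"
        using inv_into_f_f[OF inj uv(1)] inv_into_f_f[OF inj uv(2)] k fuv by simp_all
      then show ?thesis using invK[OF k(1)] xy by (intro bexI[of _ "restrict (inv_into S k) S"]) auto
    qed
    then show "inv\<^bsub>BijGroup S\<^esub> f \<in> C"
      using fB by (auto simp: inv_BijGroup C_def restrict_inv_into_Bij)
  next
    fix g f assume g: "g \<in> C" and f: "f \<in> C"
    then have B: "g \<in> Bij S" "f \<in> Bij S" by (auto simp: C_def)
    have "\<exists>k\<in>K. compose S g f x = k x \<and> compose S g f y = k y"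
      if xy: "x \<in> S" "y \<in> S" for x y
    proof -
      obtain k where k: "k \<in> K" "f x = k x" "f y = k y" using f xy by (auto simp: C_def)
      have "f x \<in> S" "f y \<in> S" using B xy Bij_imp_funcset by blast+
      then obtain l where l: "l \<in> K" "g (f x) = l (f x)" "g (f y) = l (f y)"
        using g by (auto simp: C_def)
      show ?thesis using comp[OF l(1) k(1)] k l xy
        by (intro bexI[of _ "compose S l k"]) (auto simp: compose_def)
    qed
    then show "g \<otimes>\<^bsub>BijGroup S\<^esub> f \<in> C"
      using B by (auto simp: BijGroup_def C_def compose_Bij)
  qed
  have Corb: "pair_orbits S C = pair_orbits S K"
    unfolding pair_orbits_eq_iff[OF K Csub]
  proof (intro ballI equalityI subsetI)
    fix x y v assume xy: "x \<in> S" "y \<in> S"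
    { assume "v \<in> {(f x, f y) | f. f \<in> C}"
      then obtain f where f: "f \<in> C" "v = (f x, f y)" by blast
      then obtain k where "k \<in> K" "f x = k x" "f y = k y" using xy unfolding C_def by blast
      then show "v \<in> {(f x, f y) | f. f \<in> K}" using f by auto }
    { assume "v \<in> {(f x, f y) | f. f \<in> K}"
      then show "v \<in> {(f x, f y) | f. f \<in> C}" using KC by blast }
  qed
  have great: "L \<subseteq> C" if L: "subgroup L (BijGroup S)" and o: "pair_orbits S L = pair_orbits S K"
    for L
  proof
    fix f assume f: "f \<in> L"
    have "f \<in> Bij S" using f subgroup.subset[OF L] by (auto simp: BijGroup_def)
    moreover have "\<exists>k\<in>K. f x = k x \<and> f y = k y" if xy: "x \<in> S" "y \<in> S" for x y
    proof -
      have "(f x, f y) \<in> {(f x, f y) | f. f \<in> L}" using f by blast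
      also have "\<dots> = {(f x, f y) | f. f \<in> K}" using o xy pair_orbits_eq_iff[OF K L] by blast
      finally show ?thesis by blast
    qed
    ultimately show "f \<in> C" by (simp add: C_def)
  qed
  have eq: "two_closure S K = C"
    unfolding two_closure_def by (rule Greatest_equality) (use Csub Corb great in auto)
  show "subgroup (two_closure S K) (BijGroup S)"
    "pair_orbits S (two_closure S K) = pair_orbits S K"
    "two_closure S K = {f \<in> Bij S. \<forall>x\<in>S. \<forall>y\<in>S. \<exists>k\<in>K. f x = k x \<and> f y = k y}"
    using Csub Corb unfolding eq by (simp_all add: C_def)
  show "\<And>L. subgroup L (BijGroup S) \<Longrightarrow> pair_orbits S L = pair_orbits S K \<Longrightarrow> L \<subseteq> two_closure S K"
    using great unfolding eq by blast
qed

end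

theory Submission
  imports Defs "HOL-Number_Theory.Cong"
begin

text \<open>
  The theorem follows from a statement about two factors: if an abelian group \<open>G\<close> is the direct product
  of subgroups \<open>A\<close> and \<open>B\<close> of coprime orders, then \<open>G\<close> is an NCI2-group if and only if both \<open>A\<close> and
  \<open>B\<close> are. Splitting off one Sylow subgroup at a time then gives the result by induction on the order.

  Permutations \<open>f\<close> of \<open>A\<close> and \<open>g\<close> of \<open>B\<close> together give the permutation \<open>bx f g\<close> of \<open>G\<close> that acts as
  \<open>f\<close> and \<open>g\<close> on the coordinates. Coprimality makes \<open>A\<close> and \<open>B\<close> invariant under automorphisms, so
  every element of the holomorph of \<open>G\<close> has this form (\<open>holomorph_decompose\<close>). It does not follow that a
  subgroup \<open>K\<close> of the holomorph is a product of groups on \<open>A\<close> and \<open>B\<close>: the maps \<open>x \<mapsto> c \<otimes> x\<close> and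
  \<open>x \<mapsto> c \<otimes> inv x\<close> form no such product when \<open>A\<close> and \<open>B\<close> are nontrivial of odd order.

  From \<open>G\<close> to \<open>A\<close> (\<open>NCI2_factor\<close>): a group \<open>K\<close> on \<open>A\<close> is replaced by its product with the right
  translations of \<open>B\<close>. This preserves 2-closedness and regularity, and a conjugation found in the product
  projects to one in \<open>K\<close>.

  From \<open>A\<close> and \<open>B\<close> to \<open>G\<close> (\<open>NCI2_product\<close>): a \<open>G\<close>-regular subgroup \<open>H\<close> of the holomorph is a
  product even when \<open>K\<close> is not. Its components on \<open>A\<close> and on \<open>B\<close> form abelian transitive groups, which
  therefore have the coprime orders of \<open>A\<close> and \<open>B\<close>, and a suitable power of an element of \<open>H\<close> isolates
  its component on \<open>A\<close> (\<open>regular_component\<close>). On the other side, the permutations in \<open>K\<close> that act on one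
  coordinate only form a 2-closed group on that factor (\<open>two_closed_slice\<close>). The hypothesis on the
  factors thus gives a conjugating permutation for each coordinate, and the product of the two lies in \<open>K\<close>.
\<close>

section \<open>Permutation groups\<close>

lemma BijGroup_simps:
  "carrier (BijGroup S) = Bij S"
  "\<one>\<^bsub>BijGroup S\<^esub> = (\<lambda>x\<in>S. x)"
  "f \<in> Bij S \<Longrightarrow> g \<in> Bij S \<Longrightarrow> f \<otimes>\<^bsub>BijGroup S\<^esub> g = compose S f g"
  by (simp_all add: BijGroup_def)

lemma Bij_mem: "f \<in> Bij S \<Longrightarrow> x \<in> S \<Longrightarrow> f x \<in> S"
  using Bij_imp_funcset by blast

lemma Bij_eqI: "f \<in> Bij S \<Longrightarrow> g \<in> Bij S \<Longrightarrow> (\<And>x. x \<in> S \<Longrightarrow> f x = g x) \<Longrightarrow> f = g"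
  by (meson Bij_imp_extensional extensionalityI)

lemma Bij_surj: "f \<in> Bij S \<Longrightarrow> y \<in> S \<Longrightarrow> \<exists>x\<in>S. f x = y"
  by (auto simp: Bij_def bij_betw_def image_iff) (metis imageE)

lemma Bij_finiteI:
  assumes "finite S" "f \<in> extensional S" "f \<in> S \<rightarrow> S" "inj_on f S"
  shows "f \<in> Bij S"
  using assms by (simp add: Bij_def bij_betw_def endo_inj_surj image_subset_iff_funcset)

lemma perm_subgroup_simps:
  assumes "subgroup K (BijGroup S)"
  shows "K \<subseteq> Bij S" "(\<lambda>x\<in>S. x) \<in> K" "\<And>f g. f \<in> K \<Longrightarrow> g \<in> K \<Longrightarrow> compose S f g \<in> K"
    "\<And>f g. f \<in> K \<Longrightarrow> g \<in> K \<Longrightarrow> f \<otimes>\<^bsub>BijGroup S\<^esub> g = compose S f g"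
proof -
  show *: "K \<subseteq> Bij S" using subgroup.subset[OF assms] by (simp add: BijGroup_simps)
  show "(\<lambda>x\<in>S. x) \<in> K" using subgroup.one_closed[OF assms] by (simp add: BijGroup_simps)
  show **: "f \<otimes>\<^bsub>BijGroup S\<^esub> g = compose S f g" if "f \<in> K" "g \<in> K" for f g
    using subsetD[OF * that(1)] subsetD[OF * that(2)] by (simp add: BijGroup_simps)
  show "compose S f g \<in> K" if "f \<in> K" "g \<in> K" for f g
    using subgroup.m_closed[OF assms that] **[OF that] by simp
qed

lemma two_closed_iff:
  assumes K: "subgroup K (BijGroup S)"
  shows "two_closed S K \<longleftrightarrow>
    (\<forall>f\<in>Bij S. (\<forall>x\<in>S. \<forall>y\<in>S. \<exists>k\<in>K. f x = k x \<and> f y = k y) \<longrightarrow> f \<in> K)"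
  using perm_subgroup_simps(1)[OF K] unfolding two_closed_def two_closure_eq(4)[OF K] by blast

lemma regular_on_iff:
  assumes H: "subgroup H (BijGroup S)"
  shows "regular_on S H \<longleftrightarrow> (\<forall>x\<in>S. \<forall>y\<in>S. \<exists>h\<in>H. h x = y) \<and>
    (\<forall>x\<in>S. \<forall>h\<in>H. h x = x \<longrightarrow> h = (\<lambda>x\<in>S. x))"
proof -
  have "group (perm_group S H)" using group.subgroup_imp_group[OF group_BijGroup H] .
  then have act: "group_action (perm_group S H) S (\<lambda>f. f)"
    using perm_subgroup_simps(1)[OF H] group_BijGroup
    by (auto simp: group_action_def group_hom_def group_hom_axioms_def hom_def BijGroup_simps)
  have "transitive_action (perm_group S H) S (\<lambda>f. f) \<longleftrightarrow> (\<forall>x\<in>S. \<forall>y\<in>S. \<exists>h\<in>H. h x = y)"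
    using act by (auto simp: transitive_action_def transitive_action_axioms_def)
  moreover have "stabilizer (perm_group S H) (\<lambda>f. f) x = {\<one>\<^bsub>BijGroup S\<^esub>} \<longleftrightarrow>
      (\<forall>h\<in>H. h x = x \<longrightarrow> h = (\<lambda>x\<in>S. x))" if "x \<in> S" for x
    using that perm_subgroup_simps(2)[OF H] by (auto simp: stabilizer_def BijGroup_simps)
  ultimately show ?thesis unfolding regular_on_def by auto
qed

lemma regular_bij_betw:
  assumes H: "subgroup H (BijGroup S)" and x: "x \<in> S"
    and trans: "\<And>y. y \<in> S \<Longrightarrow> \<exists>h\<in>H. h x = y"
    and semireg: "\<And>h. h \<in> H \<Longrightarrow> h x = x \<Longrightarrow> h = (\<lambda>x\<in>S. x)"
  shows "bij_betw (\<lambda>h. h x) H S"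
proof -
  interpret BG: group "BijGroup S" by (rule group_BijGroup)
  note H' = perm_subgroup_simps[OF H]
  have "f = g" if fg: "f \<in> H" "g \<in> H" "f x = g x" for f g
  proof -
    let ?i = "inv\<^bsub>BijGroup S\<^esub> g"
    have i: "?i \<in> H" using subgroup.m_inv_closed[OF H fg(2)] .
    have car: "f \<in> carrier (BijGroup S)" "g \<in> carrier (BijGroup S)"
      using fg H'(1) by (auto simp: BijGroup_simps)
    have "compose S ?i f x = compose S ?i g x" using fg(3) x by (simp add: compose_def)
    also have "\<dots> = x" using BG.l_inv[OF car(2)] H'(4)[OF i fg(2)] x by (simp add: BijGroup_simps)
    finally have "compose S ?i f = (\<lambda>x\<in>S. x)" using semireg H'(3)[OF i fg(1)] by blast
    then have "?i \<otimes>\<^bsub>BijGroup S\<^esub> f = \<one>\<^bsub>BijGroup S\<^esub>" using H'(4)[OF i fg(1)] by (simp add: BijGroup_simps)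
    then show ?thesis using BG.inv_equality[of ?i f] BG.inv_inv[OF car(2)] BG.inv_inv[OF car(1)] car
      by (metis BG.inv_closed)
  qed
  moreover have "(\<lambda>h. h x) ` H = S" using trans H'(1) x by (auto simp: image_iff Bij_mem)
  ultimately show ?thesis by (auto simp: bij_betw_def inj_on_def)
qed

text \<open>If an element \<open>f\<close> of an abelian permutation group fixes \<open>x\<close>, it fixes every \<open>h x\<close>, because \<open>f (h x) = h (f x)\<close>;
  by transitivity \<open>f\<close> is then the identity. So the group is regular.\<close>

lemma abelian_transitive_card:
  assumes K: "subgroup K (BijGroup S)" and x: "x \<in> S"
    and trans: "\<And>y. y \<in> S \<Longrightarrow> \<exists>h\<in>K. h x = y"
    and comm: "\<And>f g. f \<in> K \<Longrightarrow> g \<in> K \<Longrightarrow> compose S f g = compose S g f"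
  shows "card K = card S"
proof -
  have "f = (\<lambda>x\<in>S. x)" if f: "f \<in> K" "f x = x" for f
  proof (rule Bij_eqI[of _ S])
    fix y assume "y \<in> S"
    then obtain h where h: "h \<in> K" "h x = y" using trans by blast
    have "f y = compose S f h x" using h x by (simp add: compose_def)
    also have "\<dots> = compose S h f x" using comm f h by simp
    also have "\<dots> = y" using h f x by (simp add: compose_def)
    finally show "f y = (\<lambda>x\<in>S. x) y" using \<open>y \<in> S\<close> by simp
  qed (use f perm_subgroup_simps[OF K] in auto)
  then show ?thesis using regular_bij_betw[OF K x trans] bij_betw_same_card by blast
qed

lemma conjugate_in_iff:
  assumes "group \<Gamma>" "K \<subseteq> carrier \<Gamma>" "H \<subseteq> carrier \<Gamma>" "H' \<subseteq> carrier \<Gamma>"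
  shows "conjugate_in \<Gamma> K H H' \<longleftrightarrow> (\<exists>k\<in>K. k <#\<^bsub>\<Gamma>\<^esub> H = H' #>\<^bsub>\<Gamma>\<^esub> k)"
proof -
  interpret group \<Gamma> by fact
  have "k <#\<^bsub>\<Gamma>\<^esub> H #>\<^bsub>\<Gamma>\<^esub> inv\<^bsub>\<Gamma>\<^esub> k = H' \<longleftrightarrow> k <#\<^bsub>\<Gamma>\<^esub> H = H' #>\<^bsub>\<Gamma>\<^esub> k" if "k \<in> K" for k
  proof -
    have k: "k \<in> carrier \<Gamma>" using that assms by blast
    have l: "k <#\<^bsub>\<Gamma>\<^esub> H \<subseteq> carrier \<Gamma>" using l_coset_subset_G[OF assms(3) k] .
    show ?thesis
      using coset_mult_assoc[OF l, of "inv\<^bsub>\<Gamma>\<^esub> k" k] coset_mult_assoc[OF assms(4), of k "inv\<^bsub>\<Gamma>\<^esub> k"] k l assms(4)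
      by (auto simp: coset_mult_one)
  qed
  then show ?thesis unfolding conjugate_in_def by blast
qed

lemma r_coset_image: "H #>\<^bsub>\<Gamma>\<^esub> k = (\<lambda>h. h \<otimes>\<^bsub>\<Gamma>\<^esub> k) ` H"
  by (auto simp: r_coset_def)

lemma l_coset_image: "k <#\<^bsub>\<Gamma>\<^esub> H = (\<lambda>h. k \<otimes>\<^bsub>\<Gamma>\<^esub> h) ` H"
  by (auto simp: l_coset_def)

section \<open>The regular representation and the holomorph of an abelian group\<close>

context comm_group
begin

lemma right_translation_Bij: "g \<in> carrier G \<Longrightarrow> (\<lambda>x\<in>carrier G. x \<otimes> g) \<in> Bij (carrier G)"
  unfolding Bij_def bij_betw_def
  by (auto intro!: inj_onI simp: image_iff) (metis inv_closed inv_solve_right m_closed)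

lemma compose_right_translations:
  "g \<in> carrier G \<Longrightarrow> h \<in> carrier G \<Longrightarrow>
    compose (carrier G) (\<lambda>x\<in>carrier G. x \<otimes> g) (\<lambda>x\<in>carrier G. x \<otimes> h) = (\<lambda>x\<in>carrier G. x \<otimes> (g \<otimes> h))"
  by (auto simp: compose_def fun_eq_iff m_ac)

lemma right_translation_hom:
  "group_hom G (BijGroup (carrier G)) (\<lambda>g. \<lambda>x\<in>carrier G. x \<otimes> g)"
  using group_BijGroup
  by (auto simp: group_hom_def group_hom_axioms_def hom_def BijGroup_simps right_translation_Bij
      compose_right_translations)

lemma right_translations_subgroup: "subgroup (right_translations G) (BijGroup (carrier G))"
  using group_hom.img_is_subgroup[OF right_translation_hom] by (simp add: right_translations_def)

lemma right_translations_Bij: "right_translations G \<subseteq> Bij (carrier G)"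
  using perm_subgroup_simps(1)[OF right_translations_subgroup] .

lemma inj_right_translation: "inj_on (\<lambda>g. \<lambda>x\<in>carrier G. x \<otimes> g) (carrier G)"
proof (rule inj_onI)
  fix g h assume gh: "g \<in> carrier G" "h \<in> carrier G"
    and eq: "(\<lambda>x\<in>carrier G. x \<otimes> g) = (\<lambda>x\<in>carrier G. x \<otimes> h)"
  show "g = h" using fun_cong[OF eq, of \<one>] gh by simp
qed

lemma G_regular_right_translations: "G_regular G (right_translations G)"
proof -
  let ?R = "right_translations G" and ?t = "\<lambda>g. \<lambda>x\<in>carrier G. x \<otimes> g"
  have "?t \<in> iso G (perm_group (carrier G) ?R)"
    using group_hom.homh[OF right_translation_hom] inj_right_translation
    by (auto simp: iso_def hom_def bij_betw_def right_translations_def)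
  then have "perm_group (carrier G) ?R \<cong> G" by (meson is_isoI iso_sym)
  moreover have "\<exists>h\<in>?R. h x = y" if "x \<in> carrier G" "y \<in> carrier G" for x y
    using that by (auto simp: right_translations_def intro!: bexI[of _ "inv x \<otimes> y"] simp flip: m_assoc)
  moreover have "h = (\<lambda>x\<in>carrier G. x)" if "x \<in> carrier G" "h \<in> ?R" "h x = x" for x h
    using that by (auto simp: right_translations_def fun_eq_iff)
  ultimately show ?thesis
    by (auto simp: G_regular_def right_translations_subgroup regular_on_iff)
qed

lemma two_closed_right_translations: "two_closed (carrier G) (right_translations G)"
  unfolding two_closed_iff[OF right_translations_subgroup]
proof (intro ballI impI)
  fix f assume f: "f \<in> Bij (carrier G)"
    and two: "\<forall>x\<in>carrier G. \<forall>y\<in>carrier G. \<exists>k\<in>right_translations G. f x = k x \<and> f y = k y"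
  have "f = (\<lambda>x\<in>carrier G. x \<otimes> f \<one>)"
  proof (rule Bij_eqI[OF f])
    show "(\<lambda>x\<in>carrier G. x \<otimes> f \<one>) \<in> Bij (carrier G)" using right_translation_Bij Bij_mem[OF f] by simp
    fix x assume x: "x \<in> carrier G"
    then obtain k where "k \<in> right_translations G" "f \<one> = k \<one>" "f x = k x" using two by blast
    then show "f x = (\<lambda>x\<in>carrier G. x \<otimes> f \<one>) x" using x by (auto simp: right_translations_def)
  qed
  then show "f \<in> right_translations G" using Bij_mem[OF f] by (auto simp: right_translations_def)
qed

text \<open>Permutations in the holomorph are the affine maps \<open>x \<mapsto> \<sigma> x \<otimes> c\<close> with \<open>\<sigma>\<close> an
  automorphism. Since \<open>c = f \<one>\<close>, the identity below says that \<open>x \<mapsto> f x \<otimes> inv c\<close> is a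
  homomorphism.\<close>

lemma holomorph_iff:
  "f \<in> holomorph G \<longleftrightarrow> f \<in> Bij (carrier G) \<and>
     (\<forall>x\<in>carrier G. \<forall>y\<in>carrier G. f (x \<otimes> y) \<otimes> f \<one> = f x \<otimes> f y)"
proof -
  let ?S = "carrier G" and ?R = "right_translations G" and ?\<Gamma> = "BijGroup (carrier G)"
  let ?t = "\<lambda>g. \<lambda>x\<in>?S. x \<otimes> g"
  have R: "?R \<subseteq> carrier ?\<Gamma>" using right_translations_Bij by (simp add: BijGroup_simps)
  have "f \<in> holomorph G \<longleftrightarrow> f \<in> Bij ?S \<and> conjugate_in ?\<Gamma> {f} ?R ?R"
    using R by (auto simp: holomorph_def normalizer_def stabilizer_def conjugate_in_def BijGroup_simps)
  also have "\<dots> \<longleftrightarrow> f \<in> Bij ?S \<and> f <#\<^bsub>?\<Gamma>\<^esub> ?R = ?R #>\<^bsub>?\<Gamma>\<^esub> f"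
    using R conjugate_in_iff[OF group_BijGroup, of "{f}" ?S ?R ?R] by (auto simp: BijGroup_simps)
  also have "\<dots> \<longleftrightarrow> f \<in> Bij ?S \<and>
     (\<forall>x\<in>carrier G. \<forall>y\<in>carrier G. f (x \<otimes> y) \<otimes> f \<one> = f x \<otimes> f y)" (is "?A \<and> ?L \<longleftrightarrow> ?A \<and> ?C")
  proof (intro conj_cong refl)
    assume f: "f \<in> Bij ?S"
    note fS = Bij_mem[OF f]
    have l: "f <#\<^bsub>?\<Gamma>\<^esub> ?R = (\<lambda>g. compose ?S f (?t g)) ` ?S"
      using f by (auto simp: l_coset_image right_translations_def BijGroup_simps right_translation_Bij image_image)
    have r: "?R #>\<^bsub>?\<Gamma>\<^esub> f = (\<lambda>g. compose ?S (?t g) f) ` ?S"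
      using f by (auto simp: r_coset_image right_translations_def BijGroup_simps right_translation_Bij image_image)
    show "?L \<longleftrightarrow> ?C"
    proof
      assume L: ?L
      show ?C
      proof (intro ballI)
        fix x y assume xy: "x \<in> ?S" "y \<in> ?S"
        then have "compose ?S f (?t y) \<in> (\<lambda>g. compose ?S (?t g) f) ` ?S" using L l r by blast
        then obtain g where g: "g \<in> ?S" "compose ?S f (?t y) = compose ?S (?t g) f" by blast
        have "f (z \<otimes> y) = f z \<otimes> g" if "z \<in> ?S" for z
          using fun_cong[OF g(2), of z] that fS by (simp add: compose_def)
        from this[of x] this[of \<one>] show "f (x \<otimes> y) \<otimes> f \<one> = f x \<otimes> f y"
          using xy g(1) fS by (simp add: m_ac)
      qed
    next
      assume C: ?C
      have eq: "compose ?S f (?t g) = compose ?S (?t (f g \<otimes> inv f \<one>)) f" if g: "g \<in> ?S" for g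
      proof -
        have "f (x \<otimes> g) = f x \<otimes> (f g \<otimes> inv f \<one>)" if "x \<in> ?S" for x
          using C that g fS inv_solve_right[of "f (x \<otimes> g)" "f x \<otimes> f g" "f \<one>"] by (simp add: m_assoc)
        then show ?thesis using g fS by (auto simp: compose_def fun_eq_iff)
      qed
      have "compose ?S (?t g) f \<in> (\<lambda>g. compose ?S f (?t g)) ` ?S" if g: "g \<in> ?S" for g
      proof -
        obtain h where h: "h \<in> ?S" "f h = g \<otimes> f \<one>" using Bij_surj[OF f, of "g \<otimes> f \<one>"] g fS by auto
        then have "f h \<otimes> inv f \<one> = g" using g fS by (simp add: m_assoc)
        then show ?thesis using eq[OF h(1)] h(1) by (metis image_eqI)
      qed
      then show ?L unfolding l r using eq fS by (auto simp: image_iff intro!: bexI)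
    qed
  qed
  finally show ?thesis .
qed

lemma right_translations_subset_holomorph: "right_translations G \<subseteq> holomorph G"
  using right_translations_Bij by (auto simp: holomorph_iff right_translations_def m_ac)

end

section \<open>Coprime factors of an abelian group\<close>

lemma (in group) pow_cong:
  assumes "x \<in> carrier G" "x [^] (k::nat) = \<one>" "[m = n] (mod k)"
  shows "x [^] m = x [^] n"
proof -
  have "x [^] j = x [^] (j mod k)" for j :: nat
  proof -
    have "x [^] j = x [^] (k * (j div k) + j mod k)" by simp
    also have "\<dots> = (x [^] k) [^] (j div k) \<otimes> x [^] (j mod k)"
      using assms(1) by (simp only: nat_pow_mult nat_pow_pow)
    finally show ?thesis using assms(1,2) by simp
  qed
  from this[of m] this[of n] show ?thesis using assms(3) by (simp add: cong_def)
qed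

lemma (in group) subgroup_pow_card:
  assumes "subgroup P G" "x \<in> P"
  shows "x [^] card P = \<one>"
  using group.pow_order_eq_1[OF subgroup_imp_group[OF assms(1)], of x] assms(2)
  by (simp add: order_def flip: nat_pow_consistent)

text \<open>If \<open>x\<close> has order dividing \<open>card P\<close>, so has its image in the quotient by \<open>P\<close>, whose order \<open>n\<close> is
  coprime to \<open>card P\<close>. Hence that image is trivial.\<close>

lemma (in comm_group) subgroup_eq_torsion:
  assumes P: "subgroup P G" and ord: "order G = card P * n" and cop: "coprime (card P) n"
    and pos: "card P > 0"
  shows "P = {x \<in> carrier G. x [^] card P = \<one>}"
proof (intro equalityI subsetI)
  fix x assume "x \<in> P"
  then show "x \<in> {x \<in> carrier G. x [^] card P = \<one>}"
    using subgroup_pow_card[OF P] subgroup.subset[OF P] by auto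
next
  fix x assume "x \<in> {x \<in> carrier G. x [^] card P = \<one>}"
  then have x: "x \<in> carrier G" "x [^] card P = \<one>" by auto
  interpret N: normal P G using subgroup_imp_normal[OF P] .
  interpret Q: group "G Mod P" by (rule N.factorgroup_is_group)
  have "card (rcosets P) * card P = n * card P"
    using lagrange[OF P] ord by (metis mult.commute)
  then have "order (G Mod P) * card P = n * card P" by (simp only: order_def FactGroup_def partial_object.simps)
  then have n: "order (G Mod P) = n" using pos by simp
  have hom: "group_hom G (G Mod P) (\<lambda>a. P #> a)"
    using N.r_coset_hom_Mod by (auto simp: group_hom_def group_hom_axioms_def Q.group_axioms)
  have Px: "P #> x \<in> carrier (G Mod P)" using group_hom.hom_closed[OF hom x(1)] .
  have "P #> (x [^] n) = (P #> x) [^]\<^bsub>G Mod P\<^esub> n" using group_hom.hom_nat_pow[OF hom x(1)] .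
  also have "\<dots> = P" using Q.pow_order_eq_1[OF Px] n by (simp add: FactGroup_def)
  finally have xn: "x [^] n \<in> P" using rcos_self[of "x [^] n", OF _ P] x by simp
  obtain m where m: "[m = 1] (mod card P)" "[m = 0] (mod n)"
    using binary_chinese_remainder_nat[OF cop] by blast
  then obtain j where j: "m = n * j" by (auto simp: cong_0_iff)
  have "x = x [^] m" using pow_cong[OF x m(1)] x by simp
  also have "\<dots> = (x [^] n) [^] j" using x j by (simp add: nat_pow_pow)
  also have "\<dots> \<in> P" using xn monoid.nat_pow_closed[of "G\<lparr>carrier := P\<rparr>" "x [^] n" j]
    group.is_monoid[OF subgroup_imp_group[OF P]] by (simp flip: nat_pow_consistent)
  finally show "x \<in> P" .
qed

text \<open>The complement is the image of the endomorphism \<open>x \<mapsto> x [^] card P\<close>, whose kernel is \<open>P\<close>.\<close>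

lemma (in comm_group) coprime_complement:
  assumes P: "subgroup P G" and ord: "order G = card P * n" and cop: "coprime (card P) n"
    and pos: "card P > 0"
  shows "\<exists>Q. subgroup Q G \<and> card Q = n"
proof -
  let ?h = "\<lambda>x. x [^] card P" and ?Q = "(\<lambda>x. x [^] card P) ` carrier G"
  have hom: "group_hom G G ?h"
    by (auto simp: group_hom_def group_hom_axioms_def hom_def group_axioms nat_pow_distrib)
  have Q: "subgroup ?Q G" using group_hom.img_is_subgroup[OF hom] .
  have "group_hom G (G\<lparr>carrier := ?Q\<rparr>) ?h"
    using hom subgroup_imp_group[OF Q] by (auto simp: group_hom_def group_hom_axioms_def hom_def)
  from group_hom.FactGroup_iso[OF this]
  have "G Mod kernel G (G\<lparr>carrier := ?Q\<rparr>) ?h \<cong> G\<lparr>carrier := ?Q\<rparr>" by simp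
  moreover have "kernel G (G\<lparr>carrier := ?Q\<rparr>) ?h = P"
    using subgroup_eq_torsion[OF assms] by (simp add: kernel_def)
  ultimately have "card (carrier (G Mod P)) = card ?Q" using iso_same_card by fastforce
  moreover have "card (rcosets P) * card P = n * card P" 
    using lagrange[OF P] ord by (metis mult.commute)
  ultimately have "card ?Q = n" using pos by (simp add: FactGroup_def)
  then show ?thesis using Q by blast
qed

text \<open>When \<open>G\<close> is the product of subgroups \<open>A\<close> and \<open>B\<close> of coprime orders, the projection onto \<open>A\<close> is the
  power map whose exponent is \<open>1\<close> modulo \<open>card A\<close> and \<open>0\<close> modulo \<open>card B\<close>.\<close>

definition proj_exp :: "'a set \<Rightarrow> 'a set \<Rightarrow> nat" where
  "proj_exp A B = (SOME m. [m = 1] (mod card A) \<and> [m = 0] (mod card B))"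

definition proj :: "('a, 'b) monoid_scheme \<Rightarrow> 'a set \<Rightarrow> 'a set \<Rightarrow> 'a \<Rightarrow> 'a" where
  "proj G A B x = x [^]\<^bsub>G\<^esub> proj_exp A B"

text \<open>This is the map \<open>u \<otimes> v \<mapsto> f u \<otimes> g v\<close> for \<open>u \<in> A\<close> and \<open>v \<in> B\<close>.\<close>

definition box :: "('a, 'b) monoid_scheme \<Rightarrow> 'a set \<Rightarrow> 'a set \<Rightarrow> ('a \<Rightarrow> 'a) \<Rightarrow> ('a \<Rightarrow> 'a) \<Rightarrow> 'a \<Rightarrow> 'a" where
  "box G A B f g = (\<lambda>x\<in>carrier G. f (proj G A B x) \<otimes>\<^bsub>G\<^esub> g (proj G B A x))"

definition box_set :: "('a, 'b) monoid_scheme \<Rightarrow> 'a set \<Rightarrow> 'a set \<Rightarrow>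
    ('a \<Rightarrow> 'a) set \<Rightarrow> ('a \<Rightarrow> 'a) set \<Rightarrow> ('a \<Rightarrow> 'a) set" where
  "box_set G A B K L = (\<lambda>(f, g). box G A B f g) ` (K \<times> L)"

text \<open>The elements of a slice are permutations of \<open>A\<close>, although \<open>K\<close> acts on \<open>G\<close>, so that the notions for
  permutation groups on \<open>A\<close> apply to them.\<close>

definition slice :: "('a, 'b) monoid_scheme \<Rightarrow> 'a set \<Rightarrow> 'a set \<Rightarrow> ('a \<Rightarrow> 'a) set \<Rightarrow> ('a \<Rightarrow> 'a) set" where
  "slice G A B K = {f \<in> Bij A. box G A B f (\<lambda>x\<in>B. x) \<in> K}"

locale coprime_factors = comm_group G for G (structure) +
  fixes A B
  assumes finite_carrier: "finite (carrier G)"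
    and subgroup_A: "subgroup A G" and subgroup_B: "subgroup B G"
    and coprime_AB: "coprime (card A) (card B)"
    and order_AB: "order G = card A * card B"
begin

lemma swap: "coprime_factors G B A"
  using finite_carrier subgroup_A subgroup_B coprime_AB order_AB
  by (auto simp: coprime_factors_def coprime_factors_axioms_def comm_group_axioms
      coprime_commute mult.commute)

abbreviation pA where "pA \<equiv> proj G A B"
abbreviation pB where "pB \<equiv> proj G B A"

lemma A_carrier [simp]: "u \<in> A \<Longrightarrow> u \<in> carrier G"
  and B_carrier [simp]: "v \<in> B \<Longrightarrow> v \<in> carrier G"
  using subgroup.subset[OF subgroup_A] subgroup.subset[OF subgroup_B] by auto

lemma one_AB [simp]: "\<one> \<in> A" "\<one> \<in> B"
  using subgroup.one_closed subgroup_A subgroup_B by auto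

lemma finite_A: "finite A"
  using subgroup.subset[OF subgroup_A] finite_carrier finite_subset by blast

lemma comm_group_A: "comm_group (G\<lparr>carrier := A\<rparr>)"
  using subgroup_imp_group[OF subgroup_A]
  by (auto intro!: group.group_comm_groupI simp: m_comm)

lemma A_eq_torsion: "A = {x \<in> carrier G. x [^] card A = \<one>}"
proof (rule subgroup_eq_torsion[OF subgroup_A order_AB coprime_AB])
  show "card A > 0" using finite_A one_AB(1) card_gt_0_iff by blast
qed

lemma proj_exp: "[proj_exp A B = 1] (mod card A)" "[proj_exp A B = 0] (mod card B)"
  using someI_ex[OF binary_chinese_remainder_nat[OF coprime_AB, of 1 0]]
  unfolding proj_exp_def by auto

lemma pA_closed [simp]: "x \<in> carrier G \<Longrightarrow> pA x \<in> carrier G"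
  by (simp add: proj_def)

lemma pA_mult [simp]: "x \<in> carrier G \<Longrightarrow> y \<in> carrier G \<Longrightarrow> pA (x \<otimes> y) = pA x \<otimes> pA y"
  by (simp add: proj_def nat_pow_distrib)

lemma pA_in [simp]:
  assumes x: "x \<in> carrier G"
  shows "pA x \<in> A"
proof -
  obtain j where j: "proj_exp A B = card B * j" using proj_exp(2) by (auto simp: cong_0_iff)
  have "pA x [^] card A = (x [^] order G) [^] j"
    using x by (simp add: proj_def nat_pow_pow j order_AB mult_ac)
  then show ?thesis using pow_order_eq_1[OF x] x by (subst A_eq_torsion) simp
qed

lemma pA_A [simp]: "u \<in> A \<Longrightarrow> pA u = u"
  using pow_cong[of u "card A" "proj_exp A B" 1] proj_exp(1) subgroup_pow_card[OF subgroup_A]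
  by (simp add: proj_def)

lemma pA_B [simp]: "v \<in> B \<Longrightarrow> pA v = \<one>"
  using pow_cong[of v "card B" "proj_exp A B" 0] proj_exp(2) subgroup_pow_card[OF subgroup_B]
  by (simp add: proj_def)

lemmas pB_simps [simp] = coprime_factors.pA_closed[OF swap] coprime_factors.pA_mult[OF swap]
  coprime_factors.pA_in[OF swap] coprime_factors.pA_A[OF swap] coprime_factors.pA_B[OF swap]

text \<open>The two projection exponents add up to \<open>1\<close> modulo both coprime orders.\<close>

lemma proj_decomp: "x \<in> carrier G \<Longrightarrow> pA x \<otimes> pB x = x"
proof -
  assume x: "x \<in> carrier G"
  let ?m = "proj_exp A B" and ?n = "proj_exp B A"
  note q = coprime_factors.proj_exp[OF swap]
  have "[?m + ?n = 1 + 0] (mod card A)" "[?m + ?n = 0 + 1] (mod card B)"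
    using cong_add[OF proj_exp(1) q(2)] cong_add[OF proj_exp(2) q(1)] by blast+
  then have "[?m + ?n = 1] (mod order G)"
    using coprime_AB by (simp add: order_AB coprime_cong_mult_nat)
  then show ?thesis using pow_cong[OF x pow_order_eq_1[OF x]] x by (simp add: proj_def nat_pow_mult)
qed

section \<open>Permutations acting separately on the two factors\<close>

abbreviation bx where "bx \<equiv> box G A B"
abbreviation bxs where "bxs \<equiv> box_set G A B"

lemma box_swap:
  assumes "f \<in> Bij A" "g \<in> Bij B"
  shows "box G B A g f = bx f g"
  unfolding box_def by (rule restrict_ext) (simp add: assms Bij_mem m_comm)

lemma box_eval:
  "f \<in> Bij A \<Longrightarrow> g \<in> Bij B \<Longrightarrow> x \<in> carrier G \<Longrightarrow> bx f g x = f (pA x) \<otimes> g (pB x)"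
  by (simp add: box_def)

lemma box_closed:
  "f \<in> Bij A \<Longrightarrow> g \<in> Bij B \<Longrightarrow> x \<in> carrier G \<Longrightarrow> bx f g x \<in> carrier G"
  by (simp add: box_def Bij_mem)

lemma pA_box: "f \<in> Bij A \<Longrightarrow> g \<in> Bij B \<Longrightarrow> x \<in> carrier G \<Longrightarrow> pA (bx f g x) = f (pA x)"
  and pB_box: "f \<in> Bij A \<Longrightarrow> g \<in> Bij B \<Longrightarrow> x \<in> carrier G \<Longrightarrow> pB (bx f g x) = g (pB x)"
  by (simp_all add: box_def Bij_mem)

lemma eq_by_proj:
  assumes "x \<in> carrier G" "y \<in> carrier G" "pA x = pA y" "pB x = pB y"
  shows "x = y"
proof -
  have "x = pA x \<otimes> pB x" using assms(1) proj_decomp by simp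
  also have "\<dots> = y" unfolding assms(3,4) using assms(2) by (rule proj_decomp)
  finally show ?thesis .
qed

lemma box_Bij:
  assumes f: "f \<in> Bij A" and g: "g \<in> Bij B"
  shows "bx f g \<in> Bij (carrier G)"
proof (rule Bij_finiteI[OF finite_carrier])
  show "inj_on (bx f g) (carrier G)"
  proof (rule inj_onI)
    fix x y assume xy: "x \<in> carrier G" "y \<in> carrier G" "bx f g x = bx f g y"
    have inj: "inj_on f A" "inj_on g B" using f g by (auto simp: Bij_def bij_betw_def)
    have eq: "f (pA x) = f (pA y)" "g (pB x) = g (pB y)"
      using xy pA_box[OF f g] pB_box[OF f g] by metis+
    have "pA x = pA y" by (rule inj_onD[OF inj(1) eq(1)]) (use xy in simp_all)
    moreover have "pB x = pB y" by (rule inj_onD[OF inj(2) eq(2)]) (use xy in simp_all)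
    ultimately show "x = y" by (rule eq_by_proj[OF xy(1,2)])
  qed
qed (use f g in \<open>auto simp: box_closed\<close>, simp add: box_def)

lemma box_compose:
  assumes f: "f \<in> Bij A" "f' \<in> Bij A" and g: "g \<in> Bij B" "g' \<in> Bij B"
  shows "compose (carrier G) (bx f g) (bx f' g') = bx (compose A f f') (compose B g g')"
proof (rule Bij_eqI)
  fix x assume x: "x \<in> carrier G"
  then show "compose (carrier G) (bx f g) (bx f' g') x = bx (compose A f f') (compose B g g') x"
    using f g by (simp add: compose_eq box_eval compose_Bij Bij_mem)
qed (use assms in \<open>auto intro: compose_Bij box_Bij\<close>)

lemma box_hom:
  "group_hom (BijGroup A \<times>\<times> BijGroup B) (BijGroup (carrier G)) (\<lambda>(f, g). bx f g)"
  using group_BijGroup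
  by (auto simp: group_hom_def group_hom_axioms_def hom_def DirProd_group BijGroup_simps box_Bij
      box_compose compose_Bij)

lemma box_id: "bx (\<lambda>x\<in>A. x) (\<lambda>x\<in>B. x) = (\<lambda>x\<in>carrier G. x)"
  unfolding box_def by (rule restrict_ext) (simp add: proj_decomp)

lemma box_inj:
  assumes "f \<in> Bij A" "f' \<in> Bij A" "g \<in> Bij B" "g' \<in> Bij B" "bx f g = bx f' g'"
  shows "f = f' \<and> g = g'"
proof
  show "f = f'"
  proof (rule Bij_eqI[OF assms(1,2)])
    fix x assume "x \<in> A"
    then show "f x = f' x" using pA_box[of f g x] pA_box[of f' g' x] assms by simp
  qed
  show "g = g'"
  proof (rule Bij_eqI[OF assms(3,4)])
    fix x assume "x \<in> B"
    then show "g x = g' x" using pB_box[of f g x] pB_box[of f' g' x] assms by simp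
  qed
qed

lemma box_set_subgroup:
  assumes K: "subgroup K (BijGroup A)" and L: "subgroup L (BijGroup B)"
  shows "subgroup (bxs K L) (BijGroup (carrier G))"
  unfolding box_set_def
  using group_hom.subgroup_img_is_subgroup[OF box_hom DirProd_subgroups[OF group_BijGroup K group_BijGroup L]] .

lemma component_Bij:
  assumes F: "F \<in> Bij (carrier G)" and A: "\<And>x. x \<in> carrier G \<Longrightarrow> pA (F x) = pA (F (pA x))"
  shows "(\<lambda>u\<in>A. pA (F u)) \<in> Bij A"
proof -
  have "u \<in> (\<lambda>u. pA (F u)) ` A" if u: "u \<in> A" for u
  proof -
    obtain x where x: "x \<in> carrier G" "F x = u" using Bij_surj[OF F, of u] u by auto
    then have "u = pA (F (pA x))" using A[of x] u by simp
    then show ?thesis using x by simp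
  qed
  then have "(\<lambda>u. pA (F u)) ` A = A" using Bij_mem[OF F] by auto
  then show ?thesis using finite_A by (auto simp: Bij_def bij_betw_def finite_surj_inj)
qed

lemma box_decompose:
  assumes F: "F \<in> Bij (carrier G)"
    and A: "\<And>x. x \<in> carrier G \<Longrightarrow> pA (F x) = pA (F (pA x))"
    and B: "\<And>x. x \<in> carrier G \<Longrightarrow> pB (F x) = pB (F (pB x))"
  shows "\<exists>f\<in>Bij A. \<exists>g\<in>Bij B. F = bx f g"
proof -
  let ?f = "\<lambda>u\<in>A. pA (F u)" and ?g = "\<lambda>v\<in>B. pB (F v)"
  have fg: "?f \<in> Bij A" "?g \<in> Bij B"
    using component_Bij[OF F A] coprime_factors.component_Bij[OF swap F B] by auto
  moreover have "F = bx ?f ?g"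
  proof (rule Bij_eqI[OF F box_Bij[OF fg]])
    fix x assume x: "x \<in> carrier G"
    show "F x = bx ?f ?g x"
      using x fg A[OF x] B[OF x] Bij_mem[OF F x] proj_decomp[of "F x"] by (simp add: box_eval)
  qed
  ultimately show ?thesis by blast
qed

text \<open>A permutation \<open>F\<close> in the 2-closure agrees at \<open>x\<close> and \<open>pA x\<close> with some \<open>bx k l\<close>, so the \<open>A\<close>-coordinate
  of \<open>F x\<close> depends only on \<open>pA x\<close>. Hence \<open>F = bx f g\<close>, and agreement on pairs within a factor puts \<open>f\<close>
  and \<open>g\<close> into the 2-closures of \<open>K\<close> and \<open>L\<close>.\<close>

lemma two_closed_box_set:
  assumes K: "subgroup K (BijGroup A)" "two_closed A K"
    and L: "subgroup L (BijGroup B)" "two_closed B L"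
  shows "two_closed (carrier G) (bxs K L)"
  unfolding two_closed_iff[OF box_set_subgroup[OF K(1) L(1)]]
proof (intro ballI impI)
  fix F assume F: "F \<in> Bij (carrier G)"
    and two: "\<forall>x\<in>carrier G. \<forall>y\<in>carrier G. \<exists>k\<in>bxs K L. F x = k x \<and> F y = k y"
  note KB = perm_subgroup_simps(1)[OF K(1)] and LB = perm_subgroup_simps(1)[OF L(1)]
  have agree: "\<exists>k\<in>K. \<exists>l\<in>L. F x = bx k l x \<and> F y = bx k l y" if "x \<in> carrier G" "y \<in> carrier G" for x y
    using two that by (fastforce simp: box_set_def)
  have proj: "pA (F x) = pA (F (pA x)) \<and> pB (F x) = pB (F (pB x))" if x: "x \<in> carrier G" for x
  proof -
    obtain k l where kl: "k \<in> K" "l \<in> L" "F x = bx k l x" "F (pA x) = bx k l (pA x)"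
      using agree[of x "pA x"] x by auto
    obtain k' l' where kl': "k' \<in> K" "l' \<in> L" "F x = bx k' l' x" "F (pB x) = bx k' l' (pB x)"
      using agree[of x "pB x"] x by auto
    have "pA (F x) = pA (F (pA x))" using kl x KB LB by (auto simp: pA_box subset_iff)
    moreover have "pB (F x) = pB (F (pB x))" using kl' x KB LB by (auto simp: pB_box subset_iff)
    ultimately show ?thesis ..
  qed
  then obtain f g where fg: "f \<in> Bij A" "g \<in> Bij B" "F = bx f g" using box_decompose[OF F] by blast
  have "\<exists>k\<in>K. f x = k x \<and> f y = k y" if xy: "x \<in> A" "y \<in> A" for x y
  proof -
    obtain k l where kl: "k \<in> K" "l \<in> L" "F x = bx k l x" "F y = bx k l y"
      using agree[of x y] xy by auto
    have "f z = k z" if "z \<in> A" "F z = bx k l z" for z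
      using that pA_box[of f g z] pA_box[of k l z] fg kl KB LB by auto
    then show ?thesis using kl xy by blast
  qed
  then have "f \<in> K" using K(2) fg unfolding two_closed_iff[OF K(1)] by blast
  moreover have "\<exists>l\<in>L. g x = l x \<and> g y = l y" if xy: "x \<in> B" "y \<in> B" for x y
  proof -
    obtain k l where kl: "k \<in> K" "l \<in> L" "F x = bx k l x" "F y = bx k l y"
      using agree[of x y] xy by auto
    have "g z = l z" if "z \<in> B" "F z = bx k l z" for z
      using that pB_box[of f g z] pB_box[of k l z] fg kl KB LB by auto
    then show ?thesis using kl xy by blast
  qed
  then have "g \<in> L" using L(2) fg unfolding two_closed_iff[OF L(1)] by blast
  ultimately show "F \<in> bxs K L" using fg(3) by (auto simp: box_set_def)
qed

lemmas holomorph_A = comm_group.holomorph_iff[OF comm_group_A, simplified]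
lemmas holomorph_B = coprime_factors.holomorph_A[OF swap]

lemma box_holomorph:
  assumes f: "f \<in> holomorph (G\<lparr>carrier := A\<rparr>)" and g: "g \<in> holomorph (G\<lparr>carrier := B\<rparr>)"
  shows "bx f g \<in> holomorph G"
proof -
  have B: "f \<in> Bij A" "g \<in> Bij B" using f g by (auto simp: holomorph_A holomorph_B)
  have "bx f g (x \<otimes> y) \<otimes> bx f g \<one> = bx f g x \<otimes> bx f g y" if xy: "x \<in> carrier G" "y \<in> carrier G" for x y
  proof -
    have "bx f g (x \<otimes> y) \<otimes> bx f g \<one> =
        (f (pA x \<otimes> pA y) \<otimes> f \<one>) \<otimes> (g (pB x \<otimes> pB y) \<otimes> g \<one>)"
      using xy B subgroup.m_closed[OF subgroup_A] subgroup.m_closed[OF subgroup_B]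
      by (simp add: box_eval Bij_mem m_ac)
    also have "\<dots> = (f (pA x) \<otimes> f (pA y)) \<otimes> (g (pB x) \<otimes> g (pB y))"
      using f g xy by (simp add: holomorph_A holomorph_B)
    also have "\<dots> = bx f g x \<otimes> bx f g y"
      using xy B by (simp add: box_eval Bij_mem m_ac)
    finally show ?thesis .
  qed
  then show ?thesis using box_Bij[OF B] by (simp add: holomorph_iff)
qed

text \<open>The linear part \<open>y \<mapsto> F y \<otimes> inv (F \<one>)\<close> of an affine map sends \<open>B\<close> to itself, because the order
  of the image divides \<open>card B\<close>.\<close>

lemma holomorph_proj:
  assumes F: "F \<in> holomorph G" and x: "x \<in> carrier G"
  shows "pA (F x) = pA (F (pA x))"
proof -
  have FB: "F \<in> Bij (carrier G)"
    and aff: "\<And>x y. x \<in> carrier G \<Longrightarrow> y \<in> carrier G \<Longrightarrow> F (x \<otimes> y) \<otimes> F \<one> = F x \<otimes> F y"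
    using F by (auto simp: holomorph_iff)
  note FS = Bij_mem[OF FB]
  let ?s = "\<lambda>y. F y \<otimes> inv (F \<one>)"
  have "?s (y \<otimes> z) = ?s y \<otimes> ?s z" if yz: "y \<in> carrier G" "z \<in> carrier G" for y z
  proof -
    have "F (y \<otimes> z) = F y \<otimes> F z \<otimes> inv (F \<one>)"
      using aff[OF yz] yz FS by (simp add: inv_solve_right)
    then show ?thesis using yz FS by (simp add: m_ac)
  qed
  then have hom: "group_hom G G ?s"
    using FS by (auto simp: group_hom_def group_hom_axioms_def hom_def group_axioms)
  let ?v = "pB x"
  have "?s ?v [^] card B = ?s (?v [^] card B)"
    using group_hom.hom_nat_pow[OF hom, of ?v "card B"] x by simp
  also have "\<dots> = \<one>" using subgroup_pow_card[OF subgroup_B, of ?v] x FS by simp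
  finally have "?s ?v \<in> B"
    using x FS by (subst coprime_factors.A_eq_torsion[OF swap]) simp
  then have "pA (?s ?v) = \<one>" by simp
  moreover have "F x = F (pA x) \<otimes> ?s ?v"
  proof -
    have "F x \<otimes> F \<one> = F (pA x) \<otimes> F ?v" using aff[of "pA x" ?v] x by (simp add: proj_decomp)
    then have "F x = F (pA x) \<otimes> F ?v \<otimes> inv (F \<one>)" using x FS by (simp add: inv_solve_right)
    then show ?thesis using x FS by (simp add: m_assoc)
  qed
  ultimately show ?thesis using x FS by (metis inv_closed m_closed one_closed pA_closed pA_mult pB_simps(1) r_one)
qed

lemma holomorph_decompose:
  assumes F: "F \<in> holomorph G"
  shows "\<exists>f\<in>Bij A. \<exists>g\<in>Bij B. F = bx f g"
proof (rule box_decompose[OF _ holomorph_proj[OF F] coprime_factors.holomorph_proj[OF swap F]])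
  show "F \<in> Bij (carrier G)" using F by (simp add: holomorph_iff)
qed

lemma holomorph_component:
  assumes f: "f \<in> Bij A" and g: "g \<in> Bij B" and F: "bx f g \<in> holomorph G"
  shows "f \<in> holomorph (G\<lparr>carrier := A\<rparr>)"
proof -
  have "f (x \<otimes> y) \<otimes> f \<one> = f x \<otimes> f y" if xy: "x \<in> A" "y \<in> A" for x y
  proof -
    have "pA (bx f g (x \<otimes> y) \<otimes> bx f g \<one>) = pA (bx f g x \<otimes> bx f g y)"
      using F xy by (simp add: holomorph_iff)
    then show ?thesis using xy f g by (simp add: box_closed pA_box)
  qed
  then show ?thesis using f by (simp add: holomorph_A)
qed

lemma right_translations_box:
  "right_translations G = bxs (right_translations (G\<lparr>carrier := A\<rparr>)) (right_translations (G\<lparr>carrier := B\<rparr>))"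
proof -
  have t: "bx (\<lambda>x\<in>A. x \<otimes> u) (\<lambda>x\<in>B. x \<otimes> v) = (\<lambda>x\<in>carrier G. x \<otimes> (u \<otimes> v))" if "u \<in> A" "v \<in> B" for u v
    unfolding box_def
  proof (rule restrict_ext)
    fix x assume x: "x \<in> carrier G"
    have "(pA x \<otimes> pB x) \<otimes> (u \<otimes> v) = (pA x \<otimes> u) \<otimes> (pB x \<otimes> v)" using x that by (simp add: m_ac)
    then show "(\<lambda>x\<in>A. x \<otimes> u) (pA x) \<otimes> (\<lambda>x\<in>B. x \<otimes> v) (pB x) = x \<otimes> (u \<otimes> v)"
      using x by (simp add: proj_decomp)
  qed
  have "right_translations G = (\<lambda>(u, v). \<lambda>x\<in>carrier G. x \<otimes> (u \<otimes> v)) ` (A \<times> B)"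
  proof (intro equalityI subsetI)
    fix F assume "F \<in> right_translations G"
    then obtain g where "g \<in> carrier G" "F = (\<lambda>x\<in>carrier G. x \<otimes> g)" by (auto simp: right_translations_def)
    then show "F \<in> (\<lambda>(u, v). \<lambda>x\<in>carrier G. x \<otimes> (u \<otimes> v)) ` (A \<times> B)"
      by (intro image_eqI[of _ _ "(pA g, pB g)"]) (simp_all add: proj_decomp)
  next
    fix F assume "F \<in> (\<lambda>(u, v). \<lambda>x\<in>carrier G. x \<otimes> (u \<otimes> v)) ` (A \<times> B)"
    then obtain u v where "u \<in> A" "v \<in> B" "F = (\<lambda>x\<in>carrier G. x \<otimes> (u \<otimes> v))" by auto
    then show "F \<in> right_translations G"
      unfolding right_translations_def by (intro image_eqI[of _ _ "u \<otimes> v"]) simp_all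
  qed
  also have "\<dots> = (\<lambda>(u, v). bx (\<lambda>x\<in>A. x \<otimes> u) (\<lambda>x\<in>B. x \<otimes> v)) ` (A \<times> B)"
    by (intro image_cong) (auto simp: t)
  also have "\<dots> = bxs (right_translations (G\<lparr>carrier := A\<rparr>)) (right_translations (G\<lparr>carrier := B\<rparr>))"
    by (force simp: box_set_def right_translations_def)
  finally show ?thesis .
qed

lemma box_set_cosets:
  assumes K: "K \<subseteq> Bij A" and L: "L \<subseteq> Bij B" and k: "k \<in> Bij A" and l: "l \<in> Bij B"
  shows "bx k l <#\<^bsub>BijGroup (carrier G)\<^esub> bxs K L =
      bxs (k <#\<^bsub>BijGroup A\<^esub> K) (l <#\<^bsub>BijGroup B\<^esub> L)"
    and "bxs K L #>\<^bsub>BijGroup (carrier G)\<^esub> bx k l =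
      bxs (K #>\<^bsub>BijGroup A\<^esub> k) (L #>\<^bsub>BijGroup B\<^esub> l)"
proof -
  interpret h: group_hom "BijGroup A \<times>\<times> BijGroup B" "BijGroup (carrier G)" "\<lambda>(f, g). bx f g"
    by (rule box_hom)
  have mult: "bx f g \<otimes>\<^bsub>BijGroup (carrier G)\<^esub> bx f' g' =
      bx (f \<otimes>\<^bsub>BijGroup A\<^esub> f') (g \<otimes>\<^bsub>BijGroup B\<^esub> g')"
    if "f \<in> Bij A" "f' \<in> Bij A" "g \<in> Bij B" "g' \<in> Bij B" for f f' g g'
    using h.hom_mult[of "(f, g)" "(f', g')"] that by (simp add: BijGroup_simps)
  show "bx k l <#\<^bsub>BijGroup (carrier G)\<^esub> bxs K L =
      bxs (k <#\<^bsub>BijGroup A\<^esub> K) (l <#\<^bsub>BijGroup B\<^esub> L)"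
  proof -
    have "bx k l <#\<^bsub>BijGroup (carrier G)\<^esub> bxs K L = (\<lambda>(f, g). bx k l \<otimes>\<^bsub>BijGroup (carrier G)\<^esub> bx f g) ` (K \<times> L)"
      by (simp add: l_coset_image box_set_def image_image case_prod_unfold)
    also have "\<dots> = (\<lambda>(f, g). bx (k \<otimes>\<^bsub>BijGroup A\<^esub> f) (l \<otimes>\<^bsub>BijGroup B\<^esub> g)) ` (K \<times> L)"
      using assms by (intro image_cong) (auto simp: mult subset_iff)
    also have "\<dots> = bxs (k <#\<^bsub>BijGroup A\<^esub> K) (l <#\<^bsub>BijGroup B\<^esub> L)"
      by (force simp: l_coset_image box_set_def)
    finally show ?thesis .
  qed
  show "bxs K L #>\<^bsub>BijGroup (carrier G)\<^esub> bx k l =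
      bxs (K #>\<^bsub>BijGroup A\<^esub> k) (L #>\<^bsub>BijGroup B\<^esub> l)"
  proof -
    have "bxs K L #>\<^bsub>BijGroup (carrier G)\<^esub> bx k l = (\<lambda>(f, g). bx f g \<otimes>\<^bsub>BijGroup (carrier G)\<^esub> bx k l) ` (K \<times> L)"
      by (simp add: r_coset_image box_set_def image_image case_prod_unfold)
    also have "\<dots> = (\<lambda>(f, g). bx (f \<otimes>\<^bsub>BijGroup A\<^esub> k) (g \<otimes>\<^bsub>BijGroup B\<^esub> l)) ` (K \<times> L)"
      using assms by (intro image_cong) (auto simp: mult subset_iff)
    also have "\<dots> = bxs (K #>\<^bsub>BijGroup A\<^esub> k) (L #>\<^bsub>BijGroup B\<^esub> l)"
      by (force simp: r_coset_image box_set_def)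
    finally show ?thesis .
  qed
qed

section \<open>Regular subgroups of a product\<close>

lemma factors_iso: "G\<lparr>carrier := A\<rparr> \<times>\<times> G\<lparr>carrier := B\<rparr> \<cong> G"
proof -
  let ?m = "\<lambda>(x, y). x \<otimes> y"
  have "inj_on ?m (A \<times> B)"
  proof (rule inj_onI, clarsimp)
    fix u v u' v' assume *: "u \<in> A" "v \<in> B" "u' \<in> A" "v' \<in> B" "u \<otimes> v = u' \<otimes> v'"
    have "pA (u \<otimes> v) = pA (u' \<otimes> v')" "pB (u \<otimes> v) = pB (u' \<otimes> v')" by (simp_all only: *(5))
    then show "u = u' \<and> v = v'" using *(1-4) by simp
  qed
  moreover have "?m ` (A \<times> B) = carrier G"
  proof (intro equalityI subsetI)
    fix x assume "x \<in> carrier G"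
    then show "x \<in> ?m ` (A \<times> B)" by (intro image_eqI[of _ _ "(pA x, pB x)"]) (simp_all add: proj_decomp)
  qed auto
  moreover have "?m \<in> hom (G\<lparr>carrier := A\<rparr> \<times>\<times> G\<lparr>carrier := B\<rparr>) G"
    by (auto simp: hom_def m_ac)
  ultimately have "?m \<in> iso (G\<lparr>carrier := A\<rparr> \<times>\<times> G\<lparr>carrier := B\<rparr>) G"
    by (simp add: iso_def bij_betw_def)
  then show ?thesis by (rule is_isoI)
qed

lemma G_regular_box_set:
  assumes H: "G_regular (G\<lparr>carrier := A\<rparr>) H" and L: "G_regular (G\<lparr>carrier := B\<rparr>) L"
  shows "G_regular G (bxs H L)"
proof -
  have sub: "subgroup H (BijGroup A)" "subgroup L (BijGroup B)"
    using H L by (auto simp: G_regular_def)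
  note HB = perm_subgroup_simps(1)[OF sub(1)] and LB = perm_subgroup_simps(1)[OF sub(2)]
  note subG = box_set_subgroup[OF sub]
  have reg: "\<And>x y. x \<in> A \<Longrightarrow> y \<in> A \<Longrightarrow> \<exists>h\<in>H. h x = y" "\<And>x h. x \<in> A \<Longrightarrow> h \<in> H \<Longrightarrow> h x = x \<Longrightarrow> h = (\<lambda>x\<in>A. x)"
    "\<And>x y. x \<in> B \<Longrightarrow> y \<in> B \<Longrightarrow> \<exists>h\<in>L. h x = y" "\<And>x h. x \<in> B \<Longrightarrow> h \<in> L \<Longrightarrow> h x = x \<Longrightarrow> h = (\<lambda>x\<in>B. x)"
    using H L by (auto simp: G_regular_def regular_on_iff[OF sub(1)] regular_on_iff[OF sub(2)])
  have "regular_on (carrier G) (bxs H L)"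
    unfolding regular_on_iff[OF subG]
  proof (intro conjI ballI impI)
    fix x y assume xy: "x \<in> carrier G" "y \<in> carrier G"
    obtain f g where fg: "f \<in> H" "f (pA x) = pA y" "g \<in> L" "g (pB x) = pB y"
      using reg(1)[of "pA x" "pA y"] reg(3)[of "pB x" "pB y"] xy by auto
    then have "bx f g x = y" using xy HB LB by (simp add: box_def proj_decomp)
    then show "\<exists>h\<in>bxs H L. h x = y" using fg by (auto simp: box_set_def)
  next
    fix x F assume x: "x \<in> carrier G" "F \<in> bxs H L" "F x = x"
    then obtain f g where fg: "f \<in> H" "g \<in> L" "F = bx f g" by (auto simp: box_set_def)
    have B: "f \<in> Bij A" "g \<in> Bij B" using fg HB LB by auto
    have "f (pA x) = pA x" "g (pB x) = pB x"
      using pA_box[OF B x(1)] pB_box[OF B x(1)] x(3) fg(3) by simp_all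
    then have "f = (\<lambda>x\<in>A. x)" "g = (\<lambda>x\<in>B. x)" using reg(2)[of "pA x" f] reg(4)[of "pB x" g] x fg by auto
    then show "F = (\<lambda>x\<in>carrier G. x)" using fg box_id by simp
  qed
  moreover have "perm_group (carrier G) (bxs H L) \<cong> G"
  proof -
    have gH: "group (perm_group A H)" "group (perm_group B L)"
      using group.subgroup_imp_group[OF group_BijGroup] sub by auto
    have "(\<lambda>(f, g). bx f g) \<in> hom (perm_group A H \<times>\<times> perm_group B L) (perm_group (carrier G) (bxs H L))"
      using group_hom.homh[OF group_hom.induced_group_hom[OF box_hom
            DirProd_subgroups[OF group_BijGroup sub(1) group_BijGroup sub(2)]]]
      by (simp add: DirProd_def box_set_def)
    moreover have "inj_on (\<lambda>(f, g). bx f g) (H \<times> L)"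
    proof (rule inj_onI, clarify)
      fix f g f' g' assume "f \<in> H" "g \<in> L" "f' \<in> H" "g' \<in> L" "bx f g = bx f' g'"
      then show "f = f' \<and> g = g'" using box_inj[of f f' g g'] HB LB by blast
    qed
    ultimately have "(\<lambda>(f, g). bx f g) \<in> iso (perm_group A H \<times>\<times> perm_group B L) (perm_group (carrier G) (bxs H L))"
      by (simp add: iso_def bij_betw_def box_set_def)
    then have "perm_group (carrier G) (bxs H L) \<cong> perm_group A H \<times>\<times> perm_group B L"
      using group.iso_sym[OF DirProd_group[OF gH]] is_isoI by blast
    also have "\<dots> \<cong> G\<lparr>carrier := A\<rparr> \<times>\<times> G\<lparr>carrier := B\<rparr>"
      by (rule group.DirProd_iso_trans[OF gH(1)]) (use H L in \<open>simp_all add: G_regular_def\<close>)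
    also have "\<dots> \<cong> G" by (rule factors_iso)
    finally show ?thesis .
  qed
  ultimately show ?thesis using subG by (simp add: G_regular_def)
qed

abbreviation sl where "sl \<equiv> slice G A B"

lemma slice_hom: "group_hom (BijGroup A) (BijGroup (carrier G)) (\<lambda>f. bx f (\<lambda>x\<in>B. x))"
  using group_BijGroup box_compose[OF _ _ id_Bij id_Bij] id_Bij[of B]
  by (auto simp: group_hom_def group_hom_axioms_def hom_def BijGroup_simps box_Bij)

lemma slice_subgroup:
  assumes K: "subgroup K (BijGroup (carrier G))"
  shows "subgroup (sl K) (BijGroup A)"
proof -
  interpret h: group_hom "BijGroup A" "BijGroup (carrier G)" "\<lambda>f. bx f (\<lambda>x\<in>B. x)"
    by (rule slice_hom)
  show ?thesis
  proof (rule h.G.subgroupI)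
    show "sl K \<subseteq> carrier (BijGroup A)" by (auto simp: slice_def BijGroup_simps)
    have "(\<lambda>x\<in>A. x) \<in> sl K"
      using perm_subgroup_simps(2)[OF K] by (simp add: slice_def id_Bij box_id)
    then show "sl K \<noteq> {}" by blast
  next
    fix f assume "f \<in> sl K"
    then have f: "f \<in> carrier (BijGroup A)" "bx f (\<lambda>x\<in>B. x) \<in> K" by (auto simp: slice_def BijGroup_simps)
    show "inv\<^bsub>BijGroup A\<^esub> f \<in> sl K"
      using h.G.inv_closed[OF f(1)] h.hom_inv[OF f(1)] subgroup.m_inv_closed[OF K f(2)]
      by (simp add: slice_def BijGroup_simps)
  next
    fix f g assume "f \<in> sl K" "g \<in> sl K"
    then have fg: "f \<in> carrier (BijGroup A)" "bx f (\<lambda>x\<in>B. x) \<in> K" "g \<in> carrier (BijGroup A)" "bx g (\<lambda>x\<in>B. x) \<in> K"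
      by (auto simp: slice_def BijGroup_simps)
    show "f \<otimes>\<^bsub>BijGroup A\<^esub> g \<in> sl K"
      using h.G.m_closed[OF fg(1,3)] h.hom_mult[OF fg(1,3)] subgroup.m_closed[OF K fg(2,4)]
      unfolding slice_def by (simp add: BijGroup_simps(1))
  qed
qed

text \<open>Agreement of \<open>f\<close> on a pair with an element of the slice gives agreement of
  \<open>bx f id\<close>, on every pair in \<open>G\<close> that projects to it, with an element of \<open>K\<close>.\<close>

lemma two_closed_slice:
  assumes K: "subgroup K (BijGroup (carrier G))" and tc: "two_closed (carrier G) K"
  shows "two_closed A (sl K)"
  unfolding two_closed_iff[OF slice_subgroup[OF K]]
proof (intro ballI impI)
  fix f assume f: "f \<in> Bij A" and two: "\<forall>x\<in>A. \<forall>y\<in>A. \<exists>k\<in>sl K. f x = k x \<and> f y = k y"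
  let ?e = "\<lambda>f. bx f (\<lambda>x\<in>B. x)"
  have "\<exists>k\<in>K. ?e f x = k x \<and> ?e f y = k y" if xy: "x \<in> carrier G" "y \<in> carrier G" for x y
  proof -
    obtain k where k: "k \<in> sl K" "f (pA x) = k (pA x)" "f (pA y) = k (pA y)"
      using two pA_in[OF xy(1)] pA_in[OF xy(2)] by blast
    then have "?e f x = ?e k x" "?e f y = ?e k y" using xy by (simp_all add: box_def)
    then show ?thesis using k(1) by (auto simp: slice_def)
  qed
  then have "?e f \<in> K"
    using tc box_Bij[OF f id_Bij] unfolding two_closed_iff[OF K] by blast
  then show "f \<in> sl K" using f by (simp add: slice_def)
qed

text \<open>Every element of \<open>H\<close> has a component on \<open>A\<close>, as \<open>H\<close> lies in the holomorph. These components form an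
  abelian group because \<open>H \<cong> G\<close>, and a transitive one because \<open>H\<close> is transitive; so there are
  \<open>card A\<close> of them.\<close>

lemma component_pow_card:
  assumes H: "G_regular G H" "H \<subseteq> holomorph G" and fg: "f \<in> Bij A" "g \<in> Bij B" "bx f g \<in> H"
  shows "f [^]\<^bsub>BijGroup A\<^esub> card A = (\<lambda>x\<in>A. x)"
proof -
  have sub: "subgroup H (BijGroup (carrier G))" using H by (simp add: G_regular_def)
  have reg: "\<And>x y. x \<in> carrier G \<Longrightarrow> y \<in> carrier G \<Longrightarrow> \<exists>h\<in>H. h x = y"
    using H(1) by (auto simp: G_regular_def regular_on_iff[OF sub])
  have gH: "group (perm_group (carrier G) H)" using group.subgroup_imp_group[OF group_BijGroup sub] .
  have "G \<cong> perm_group (carrier G) H" using H(1) by (intro group.iso_sym[OF gH]) (simp add: G_regular_def)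
  then have "comm_group (perm_group (carrier G) H)"
    using iso_imp_comm_group group.is_monoid[OF gH] by blast
  then have comm: "compose (carrier G) F F' = compose (carrier G) F' F" if "F \<in> H" "F' \<in> H" for F F'
    using comm_groupE(4)[of "perm_group (carrier G) H" F F'] that perm_subgroup_simps(4)[OF sub] by simp
  define C where "C = {f \<in> Bij A. \<exists>g\<in>Bij B. bx f g \<in> H}"
  have C: "subgroup C (BijGroup A)"
  proof -
    interpret h: group_hom "BijGroup A \<times>\<times> BijGroup B" "BijGroup (carrier G)" "\<lambda>(f, g). bx f g"
      by (rule box_hom)
    have gA: "group (BijGroup A)" and gB: "group (BijGroup B)" by (rule group_BijGroup)+
    show ?thesis
    proof (rule group.subgroupI[OF gA])
      show "C \<subseteq> carrier (BijGroup A)" by (auto simp: C_def BijGroup_simps)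
      have "(\<lambda>x\<in>A. x) \<in> C"
        using perm_subgroup_simps(2)[OF sub] unfolding C_def by (auto simp: id_Bij box_id intro!: bexI[of _ "\<lambda>x\<in>B. x"])
      then show "C \<noteq> {}" by blast
    next
      fix f assume "f \<in> C"
      then obtain g where fg: "f \<in> carrier (BijGroup A)" "g \<in> carrier (BijGroup B)" "bx f g \<in> H"
        by (auto simp: C_def BijGroup_simps)
      have "bx (inv\<^bsub>BijGroup A\<^esub> f) (inv\<^bsub>BijGroup B\<^esub> g) = inv\<^bsub>BijGroup (carrier G)\<^esub> (bx f g)"
        using h.hom_inv[of "(f, g)"] fg by (simp add: inv_DirProd[OF gA gB])
      then have "bx (inv\<^bsub>BijGroup A\<^esub> f) (inv\<^bsub>BijGroup B\<^esub> g) \<in> H"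
        using subgroup.m_inv_closed[OF sub fg(3)] by simp
      then show "inv\<^bsub>BijGroup A\<^esub> f \<in> C"
        using group.inv_closed[OF gA fg(1)] group.inv_closed[OF gB fg(2)]
        unfolding C_def BijGroup_simps(1) by blast
    next
      fix f f' assume "f \<in> C" "f' \<in> C"
      then obtain g g' where fg: "f \<in> Bij A" "g \<in> Bij B" "bx f g \<in> H" "f' \<in> Bij A" "g' \<in> Bij B" "bx f' g' \<in> H"
        by (auto simp: C_def)
      then have "bx (compose A f f') (compose B g g') \<in> H"
        using perm_subgroup_simps(3)[OF sub fg(3,6)] by (simp add: box_compose)
      then show "f \<otimes>\<^bsub>BijGroup A\<^esub> f' \<in> C" using fg by (auto simp: C_def BijGroup_simps compose_Bij)
    qed
  qed
  have "card C = card A"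
  proof (rule abelian_transitive_card[OF C one_AB(1)])
    fix y assume y: "y \<in> A"
    then obtain F where F: "F \<in> H" "F \<one> = y" using reg[of \<one> y] by auto
    then obtain f g where fg: "f \<in> Bij A" "g \<in> Bij B" "F = bx f g"
      using holomorph_decompose H(2) by blast
    then have "f \<one> = y" using pA_box[OF fg(1,2), of \<one>] F y by simp
    then show "\<exists>h\<in>C. h \<one> = y" using fg F by (auto simp: C_def)
  next
    fix f f' assume "f \<in> C" "f' \<in> C"
    then obtain g g' where fg: "f \<in> Bij A" "g \<in> Bij B" "bx f g \<in> H" "f' \<in> Bij A" "g' \<in> Bij B" "bx f' g' \<in> H"
      by (auto simp: C_def)
    then have "bx (compose A f f') (compose B g g') = bx (compose A f' f) (compose B g' g)"
      using comm[OF fg(3,6)] by (simp add: box_compose)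
    then show "compose A f f' = compose A f' f"
      using box_inj fg compose_Bij by meson
  qed
  moreover have "f \<in> C" using fg by (auto simp: C_def)
  ultimately show ?thesis
    using group.subgroup_pow_card[OF group_BijGroup C, of f] by (simp add: BijGroup_simps)
qed

text \<open>The orders of \<open>f\<close> and \<open>g\<close> divide \<open>card A\<close> and \<open>card B\<close>. So the power of \<open>bx f g\<close> with exponent \<open>1\<close>
  modulo \<open>card A\<close> and \<open>0\<close> modulo \<open>card B\<close> keeps \<open>f\<close> and turns \<open>g\<close> into the identity.\<close>

lemma regular_component:
  assumes H: "G_regular G H" "H \<subseteq> holomorph G" and fg: "f \<in> Bij A" "g \<in> Bij B" "bx f g \<in> H"
  shows "f \<in> sl H"
proof -
  have sub: "subgroup H (BijGroup (carrier G))" using H by (simp add: G_regular_def)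
  interpret h: group_hom "BijGroup A \<times>\<times> BijGroup B" "BijGroup (carrier G)" "\<lambda>(f, g). bx f g"
    by (rule box_hom)
  have gA: "group (BijGroup A)" and gB: "group (BijGroup B)" by (rule group_BijGroup)+
  have pow: "(f, g) [^]\<^bsub>BijGroup A \<times>\<times> BijGroup B\<^esub> n = (f [^]\<^bsub>BijGroup A\<^esub> n, g [^]\<^bsub>BijGroup B\<^esub> n)"
    for n :: nat by (induction n) simp_all
  have "g [^]\<^bsub>BijGroup B\<^esub> card B = (\<lambda>x\<in>B. x)"
    using coprime_factors.component_pow_card[OF swap H fg(2,1)] fg by (simp add: box_swap)
  then have g1: "g [^]\<^bsub>BijGroup B\<^esub> proj_exp A B = (\<lambda>x\<in>B. x)"
    using group.pow_cong[OF gB, of g "card B" "proj_exp A B" 0] proj_exp(2) fg by (simp add: BijGroup_simps)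
  have f1: "f [^]\<^bsub>BijGroup A\<^esub> proj_exp A B = f"
    using group.pow_cong[OF gA, of f "card A" "proj_exp A B" 1] proj_exp(1) fg
      component_pow_card[OF H fg] monoid.l_one[OF group.is_monoid[OF gA], of f]
    by (simp add: BijGroup_simps)
  have "bx f g [^]\<^bsub>BijGroup (carrier G)\<^esub> proj_exp A B = bx f (\<lambda>x\<in>B. x)"
    using h.hom_nat_pow[of "(f, g)" "proj_exp A B"] fg by (simp add: pow f1 g1 BijGroup_simps)
  moreover have "bx f g [^]\<^bsub>BijGroup (carrier G)\<^esub> n \<in> H" for n :: nat
    using subgroup.one_closed[OF sub] subgroup.m_closed[OF sub _ fg(3)] by (induction n) auto
  ultimately show ?thesis using fg by (metis (mono_tags, lifting) mem_Collect_eq slice_def)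
qed

text \<open>An isomorphism \<open>H \<cong> G\<close> carries the slice, whose elements have orders dividing \<open>card A\<close>, into
  \<open>A\<close>; equality holds because the slice is regular on \<open>A\<close> and hence has \<open>card A\<close> elements.\<close>

lemma G_regular_slice:
  assumes H: "G_regular G H" "H \<subseteq> holomorph G"
  shows "G_regular (G\<lparr>carrier := A\<rparr>) (sl H)"
proof -
  have sub: "subgroup H (BijGroup (carrier G))" using H by (simp add: G_regular_def)
  note ssub = slice_subgroup[OF sub]
  note SB = perm_subgroup_simps(1)[OF ssub]
  have reg: "\<And>x y. x \<in> carrier G \<Longrightarrow> y \<in> carrier G \<Longrightarrow> \<exists>h\<in>H. h x = y"
    "\<And>x h. x \<in> carrier G \<Longrightarrow> h \<in> H \<Longrightarrow> h x = x \<Longrightarrow> h = (\<lambda>x\<in>carrier G. x)"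
    using H(1) by (auto simp: G_regular_def regular_on_iff[OF sub])
  have trans: "\<exists>h\<in>sl H. h x = y" if xy: "x \<in> A" "y \<in> A" for x y
  proof -
    obtain F where F: "F \<in> H" "F x = y" using reg(1)[of x y] xy by auto
    then obtain f g where fg: "f \<in> Bij A" "g \<in> Bij B" "F = bx f g"
      using holomorph_decompose H(2) by blast
    then have "f x = y" using pA_box[OF fg(1,2), of x] F xy by simp
    then show ?thesis using regular_component[OF H fg(1,2)] F fg by auto
  qed
  have semireg: "h = (\<lambda>x\<in>A. x)" if x: "x \<in> A" "h \<in> sl H" "h x = x" for x h
  proof -
    have h: "h \<in> Bij A" "bx h (\<lambda>x\<in>B. x) \<in> H" using x by (auto simp: slice_def)
    have "bx h (\<lambda>x\<in>B. x) x = x" using x by (simp add: box_def)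
    then have "bx h (\<lambda>x\<in>B. x) = bx (\<lambda>x\<in>A. x) (\<lambda>x\<in>B. x)" using reg(2)[of x] x h box_id by simp
    then show ?thesis using box_inj[OF h(1) id_Bij id_Bij id_Bij] by blast
  qed
  have card: "card (sl H) = card A"
    using regular_bij_betw[OF ssub one_AB(1)] trans semireg bij_betw_same_card one_AB(1) by blast
  obtain \<phi> where \<phi>: "\<phi> \<in> iso (perm_group (carrier G) H) G"
    using H(1) by (auto simp: G_regular_def is_iso_def)
  let ?\<psi> = "\<lambda>f. \<phi> (bx f (\<lambda>x\<in>B. x))"
  have gS: "group (perm_group A (sl H))" using group.subgroup_imp_group[OF group_BijGroup ssub] .
  have hom: "group_hom (perm_group A (sl H)) G ?\<psi>"
  proof -
    have "\<phi> (bx (f \<otimes>\<^bsub>BijGroup A\<^esub> g) (\<lambda>x\<in>B. x)) = \<phi> (bx f (\<lambda>x\<in>B. x)) \<otimes> \<phi> (bx g (\<lambda>x\<in>B. x))"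
      if "f \<in> sl H" "g \<in> sl H" for f g
      using that \<phi> group_hom.hom_mult[OF slice_hom, of f g] SB
      by (auto simp: iso_def hom_def slice_def BijGroup_simps(1))
    then show ?thesis
      using \<phi> gS group_axioms by (auto simp: group_hom_def group_hom_axioms_def hom_def iso_def slice_def)
  qed
  have inj: "inj_on ?\<psi> (sl H)"
  proof (rule inj_onI)
    fix f g assume *: "f \<in> sl H" "g \<in> sl H" "?\<psi> f = ?\<psi> g"
    then have "bx f (\<lambda>x\<in>B. x) = bx g (\<lambda>x\<in>B. x)"
      using \<phi> by (auto simp: iso_def bij_betw_def slice_def dest: inj_onD)
    then show "f = g" using box_inj[OF _ _ id_Bij id_Bij] * by (auto simp: slice_def)
  qed
  have "?\<psi> ` sl H \<subseteq> A"
  proof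
    fix z assume "z \<in> ?\<psi> ` sl H"
    then obtain f where f: "f \<in> sl H" "z = ?\<psi> f" by auto
    have "z [^] card A = ?\<psi> (f [^]\<^bsub>perm_group A (sl H)\<^esub> card A)"
      using group_hom.hom_nat_pow[OF hom, of f "card A"] f by simp
    also have "f [^]\<^bsub>perm_group A (sl H)\<^esub> card A = \<one>\<^bsub>perm_group A (sl H)\<^esub>"
      using group.pow_order_eq_1[OF gS, of f] f card by (simp add: order_def)
    also have "?\<psi> \<dots> = \<one>" using group_hom.hom_one[OF hom] .
    finally show "z \<in> A"
      using group_hom.hom_closed[OF hom, of f] f by (subst A_eq_torsion) simp
  qed
  then have "?\<psi> ` sl H = A"
    using card_image[OF inj] card finite_A by (simp add: card_subset_eq)
  then have "?\<psi> \<in> iso (perm_group A (sl H)) (G\<lparr>carrier := A\<rparr>)"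
    using group_hom.homh[OF hom] inj by (auto simp: iso_def hom_def bij_betw_def)
  then show ?thesis
    using ssub trans semireg by (auto simp: G_regular_def regular_on_iff[OF ssub] intro: is_isoI)
qed


lemma box_set_slices_subset:
  assumes K: "subgroup K (BijGroup (carrier G))"
  shows "bxs (sl K) (slice G B A K) \<subseteq> K"
proof
  fix F assume "F \<in> bxs (sl K) (slice G B A K)"
  then obtain f g where F: "F = bx f g"
    and f: "f \<in> Bij A" "bx f (\<lambda>x\<in>B. x) \<in> K" and g: "g \<in> Bij B" "box G B A g (\<lambda>x\<in>A. x) \<in> K"
    by (auto simp: box_set_def slice_def)
  have "bx (\<lambda>x\<in>A. x) g \<in> K" using g by (simp add: box_swap id_Bij)
  then have "compose (carrier G) (bx f (\<lambda>x\<in>B. x)) (bx (\<lambda>x\<in>A. x) g) \<in> K"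
    using perm_subgroup_simps(3)[OF K f(2)] by blast
  also have "compose (carrier G) (bx f (\<lambda>x\<in>B. x)) (bx (\<lambda>x\<in>A. x) g) =
      bx (compose A f (\<lambda>x\<in>A. x)) (compose B (\<lambda>x\<in>B. x) g)"
    by (rule box_compose[OF f(1) id_Bij id_Bij g(1)])
  also have "\<dots> = F"
    using compose_Id[OF Bij_imp_funcset[OF f(1)] Bij_imp_extensional[OF f(1)]]
      Id_compose[OF Bij_imp_funcset[OF g(1)] Bij_imp_extensional[OF g(1)]] F by simp
  finally show "F \<in> K" .
qed

lemma regular_eq_box_set:
  assumes H: "G_regular G H" "H \<subseteq> holomorph G"
  shows "H = bxs (sl H) (slice G B A H)"
proof
  show "bxs (sl H) (slice G B A H) \<subseteq> H"
    using H box_set_slices_subset by (simp add: G_regular_def)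
  show "H \<subseteq> bxs (sl H) (slice G B A H)"
  proof
    fix F assume F: "F \<in> H"
    then obtain f g where fg: "f \<in> Bij A" "g \<in> Bij B" "F = bx f g"
      using holomorph_decompose H(2) by blast
    have "f \<in> sl H" using regular_component[OF H fg(1,2)] F fg(3) by simp
    moreover have "g \<in> slice G B A H"
      using coprime_factors.regular_component[OF swap H fg(2,1)] F fg by (simp add: box_swap)
    ultimately show "F \<in> bxs (sl H) (slice G B A H)" using fg(3) by (auto simp: box_set_def)
  qed
qed

lemma box_set_Bij: "K \<subseteq> Bij A \<Longrightarrow> L \<subseteq> Bij B \<Longrightarrow> bxs K L \<subseteq> Bij (carrier G)"
  by (auto simp: box_set_def intro!: box_Bij)

lemma box_set_subset_imp:
  assumes "K \<subseteq> Bij A" "L \<subseteq> Bij B" "K' \<subseteq> Bij A" "L' \<subseteq> Bij B"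
    and "L \<noteq> {}" "bxs K L \<subseteq> bxs K' L'"
  shows "K \<subseteq> K'"
proof
  fix f assume f: "f \<in> K"
  obtain g where g: "g \<in> L" using assms(5) by blast
  then have "bx f g \<in> bxs K' L'" using f assms(6) by (auto simp: box_set_def)
  then obtain f' g' where "f' \<in> K'" "g' \<in> L'" "bx f g = bx f' g'" by (auto simp: box_set_def)
  then show "f \<in> K'" using box_inj[of f f' g g'] f g assms(1-4) by blast
qed

lemma box_set_mono_holomorph:
  assumes "K \<subseteq> holomorph (G\<lparr>carrier := A\<rparr>)" "L \<subseteq> holomorph (G\<lparr>carrier := B\<rparr>)"
  shows "bxs K L \<subseteq> holomorph G"
  using assms box_holomorph by (auto simp: box_set_def)

section \<open>Passing between a product and its factors\<close>

text \<open>A 2-closed group \<open>K\<close> on \<open>A\<close> is enlarged by the right translations of \<open>B\<close>. A conjugation in the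
  product group can be read off on the factor \<open>A\<close>, because \<open>f\<close> is determined by \<open>bx f g\<close>.\<close>

lemma NCI2_factor:
  assumes NCI: "NCI2_group G"
  shows "NCI2_group (G\<lparr>carrier := A\<rparr>)"
  unfolding NCI2_group_def G_transjugate_def partial_object.simps
proof (intro allI impI, elim conjE)
  fix K H
  let ?RA = "right_translations (G\<lparr>carrier := A\<rparr>)" and ?RB = "right_translations (G\<lparr>carrier := B\<rparr>)"
  let ?R = "right_translations G"
  assume K: "subgroup K (BijGroup (carrier (G\<lparr>carrier := A\<rparr>)))" "two_closed (carrier (G\<lparr>carrier := A\<rparr>)) K"
    "?RA \<subseteq> K" "K \<subseteq> holomorph (G\<lparr>carrier := A\<rparr>)"
    and H: "G_regular (G\<lparr>carrier := A\<rparr>) H" "H \<subseteq> K"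
  interpret CA: comm_group "G\<lparr>carrier := A\<rparr>" by (rule comm_group_A)
  interpret CB: comm_group "G\<lparr>carrier := B\<rparr>" by (rule coprime_factors.comm_group_A[OF swap])
  have K': "subgroup K (BijGroup A)" "two_closed A K" using K by simp_all
  have RB: "subgroup ?RB (BijGroup B)" "two_closed B ?RB"
    using CB.right_translations_subgroup CB.two_closed_right_translations by simp_all
  have KB: "K \<subseteq> Bij A" and RBB: "?RB \<subseteq> Bij B" and RAB: "?RA \<subseteq> Bij A"
    using perm_subgroup_simps(1) K' RB CA.right_translations_Bij by auto
  have HB: "H \<subseteq> Bij A" using H KB by blast
  have "G_transjugate G (bxs K ?RB)"
  proof -
    have "?R \<subseteq> bxs K ?RB"
      unfolding right_translations_box using K(3) by (auto simp: box_set_def)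
    then show ?thesis
      using NCI box_set_subgroup[OF K'(1) RB(1)] two_closed_box_set[OF K' RB]
        box_set_mono_holomorph[OF K(4) CB.right_translations_subset_holomorph]
      unfolding NCI2_group_def by blast
  qed
  moreover have "G_regular G (bxs H ?RB)"
    by (rule G_regular_box_set[OF H(1) CB.G_regular_right_translations])
  moreover have "bxs H ?RB \<subseteq> bxs K ?RB" using H(2) by (auto simp: box_set_def)
  ultimately have "conjugate_in (BijGroup (carrier G)) (bxs K ?RB) (bxs H ?RB) ?R"
    unfolding G_transjugate_def by blast
  moreover have "bxs K ?RB \<subseteq> carrier (BijGroup (carrier G))" "bxs H ?RB \<subseteq> carrier (BijGroup (carrier G))"
    using KB HB RBB by (simp_all add: box_set_Bij BijGroup_simps(1))
  ultimately obtain k l where kl: "k \<in> K" "l \<in> ?RB"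
    and "bx k l <#\<^bsub>BijGroup (carrier G)\<^esub> bxs H ?RB = ?R #>\<^bsub>BijGroup (carrier G)\<^esub> bx k l"
    using right_translations_Bij by (subst (asm) conjugate_in_iff) (auto simp: group_BijGroup BijGroup_simps box_set_def)
  moreover have klB: "k \<in> Bij A" "l \<in> Bij B" using kl KB RBB by auto
  ultimately have eq: "bxs (k <#\<^bsub>BijGroup A\<^esub> H) (l <#\<^bsub>BijGroup B\<^esub> ?RB) =
      bxs (?RA #>\<^bsub>BijGroup A\<^esub> k) (?RB #>\<^bsub>BijGroup B\<^esub> l)"
    unfolding right_translations_box by (simp add: box_set_cosets HB RBB RAB)
  have cos: "k <#\<^bsub>BijGroup A\<^esub> H \<subseteq> Bij A" "l <#\<^bsub>BijGroup B\<^esub> ?RB \<subseteq> Bij B"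
    "?RA #>\<^bsub>BijGroup A\<^esub> k \<subseteq> Bij A" "?RB #>\<^bsub>BijGroup B\<^esub> l \<subseteq> Bij B"
    using group.l_coset_subset_G[OF group_BijGroup, of H A k]
      group.l_coset_subset_G[OF group_BijGroup, of ?RB B l]
      monoid.r_coset_subset_G[OF group.is_monoid[OF group_BijGroup], of ?RA A k]
      monoid.r_coset_subset_G[OF group.is_monoid[OF group_BijGroup], of ?RB B l] HB RBB RAB klB
    by (simp_all add: BijGroup_simps(1))
  have ne: "l <#\<^bsub>BijGroup B\<^esub> ?RB \<noteq> {}" "?RB #>\<^bsub>BijGroup B\<^esub> l \<noteq> {}"
    using kl by (auto simp: l_coset_image r_coset_image)
  have "k <#\<^bsub>BijGroup A\<^esub> H = ?RA #>\<^bsub>BijGroup A\<^esub> k"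
    using box_set_subset_imp[OF cos ne(1)] box_set_subset_imp[OF cos(3,4,1,2) ne(2)] eq by blast
  then have "conjugate_in (BijGroup A) K H ?RA"
    using kl KB HB RAB by (subst conjugate_in_iff) (auto simp: group_BijGroup BijGroup_simps(1))
  then show "conjugate_in (BijGroup (carrier (G\<lparr>carrier := A\<rparr>))) K H ?RA" by simp
qed

lemma slice_mono: "K \<subseteq> L \<Longrightarrow> sl K \<subseteq> sl L"
  by (auto simp: slice_def)

lemma slice_conjugate:
  assumes NCI: "NCI2_group (G\<lparr>carrier := A\<rparr>)"
    and K: "subgroup K (BijGroup (carrier G))" "two_closed (carrier G) K"
    and RK: "right_translations G \<subseteq> K" and KH: "K \<subseteq> holomorph G"
    and H: "G_regular G H" "H \<subseteq> K"
  shows "\<exists>k\<in>sl K. k <#\<^bsub>BijGroup A\<^esub> sl H = right_translations (G\<lparr>carrier := A\<rparr>) #>\<^bsub>BijGroup A\<^esub> k"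
proof -
  let ?RA = "right_translations (G\<lparr>carrier := A\<rparr>)"
  interpret CA: comm_group "G\<lparr>carrier := A\<rparr>" by (rule comm_group_A)
  interpret CB: comm_group "G\<lparr>carrier := B\<rparr>" by (rule coprime_factors.comm_group_A[OF swap])
  have RAB: "?RA \<subseteq> Bij A" using CA.right_translations_Bij by simp
  have "?RA \<subseteq> sl K"
  proof
    fix f assume f: "f \<in> ?RA"
    have "(\<lambda>x\<in>B. x) \<in> right_translations (G\<lparr>carrier := B\<rparr>)"
      using perm_subgroup_simps(2)[OF CB.right_translations_subgroup] by simp
    then have "bx f (\<lambda>x\<in>B. x) \<in> right_translations G"
      using f unfolding right_translations_box by (auto simp: box_set_def)
    then show "f \<in> sl K" using f RAB RK by (auto simp: slice_def)
  qed
  moreover have "sl K \<subseteq> holomorph (G\<lparr>carrier := A\<rparr>)"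
    using holomorph_component[OF _ id_Bij] KH by (auto simp: slice_def)
  ultimately have "G_transjugate (G\<lparr>carrier := A\<rparr>) (sl K)"
    using NCI slice_subgroup[OF K(1)] two_closed_slice[OF K] unfolding NCI2_group_def by simp
  moreover have "G_regular (G\<lparr>carrier := A\<rparr>) (sl H)" using G_regular_slice H KH by blast
  ultimately have "conjugate_in (BijGroup A) (sl K) (sl H) ?RA"
    using slice_mono[OF H(2)] unfolding G_transjugate_def by simp
  then show ?thesis
    using RAB by (subst (asm) conjugate_in_iff) (auto simp: group_BijGroup BijGroup_simps slice_def)
qed

text \<open>A \<open>G\<close>-regular \<open>H\<close> is the product of its two slices. These are conjugated to the right translations of
  \<open>A\<close> and \<open>B\<close> by elements of the slices of \<open>K\<close>, whose product is again in \<open>K\<close>.\<close>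

lemma NCI2_product:
  assumes A: "NCI2_group (G\<lparr>carrier := A\<rparr>)" and B: "NCI2_group (G\<lparr>carrier := B\<rparr>)"
  shows "NCI2_group G"
  unfolding NCI2_group_def G_transjugate_def
proof (intro allI impI, elim conjE)
  fix K H
  let ?RA = "right_translations (G\<lparr>carrier := A\<rparr>)" and ?RB = "right_translations (G\<lparr>carrier := B\<rparr>)"
  assume K: "subgroup K (BijGroup (carrier G))" "two_closed (carrier G) K"
    "right_translations G \<subseteq> K" "K \<subseteq> holomorph G" and H: "G_regular G H" "H \<subseteq> K"
  obtain k where k: "k \<in> sl K" "k <#\<^bsub>BijGroup A\<^esub> sl H = ?RA #>\<^bsub>BijGroup A\<^esub> k"
    using slice_conjugate[OF A K H] by blast
  obtain l where l: "l \<in> slice G B A K" "l <#\<^bsub>BijGroup B\<^esub> slice G B A H = ?RB #>\<^bsub>BijGroup B\<^esub> l"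
    using coprime_factors.slice_conjugate[OF swap B K H] by blast
  have sub: "sl H \<subseteq> Bij A" "slice G B A H \<subseteq> Bij B" "k \<in> Bij A" "l \<in> Bij B"
    using k l by (auto simp: slice_def)
  have R: "?RA \<subseteq> Bij A" "?RB \<subseteq> Bij B"
    using comm_group.right_translations_Bij[OF comm_group_A]
      comm_group.right_translations_Bij[OF coprime_factors.comm_group_A[OF swap]] by simp_all
  have "bx k l <#\<^bsub>BijGroup (carrier G)\<^esub> bxs (sl H) (slice G B A H) =
      bxs ?RA ?RB #>\<^bsub>BijGroup (carrier G)\<^esub> bx k l"
    unfolding box_set_cosets(1)[OF sub] box_set_cosets(2)[OF R sub(3,4)] k(2) l(2) ..
  then have "bx k l <#\<^bsub>BijGroup (carrier G)\<^esub> H = right_translations G #>\<^bsub>BijGroup (carrier G)\<^esub> bx k l"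
    using regular_eq_box_set[OF H(1)] H(2) K(4) unfolding right_translations_box by auto
  moreover have "bx k l \<in> K" using box_set_slices_subset[OF K(1)] k(1) l(1) by (auto simp: box_set_def)
  moreover have "K \<subseteq> carrier (BijGroup (carrier G))" by (rule subgroup.subset[OF K(1)])
  ultimately show "conjugate_in (BijGroup (carrier G)) K H (right_translations G)"
    using H(2) K(3) by (subst conjugate_in_iff) (auto simp: group_BijGroup)
qed

end

section \<open>Reduction to Sylow subgroups\<close>

lemma (in group) finite_subgroup_card_pos:
  assumes "finite (carrier G)" "subgroup P G"
  shows "card P > 0"
  using assms subgroup.subset[OF assms(2)] subgroup.one_closed[OF assms(2)] finite_subset card_gt_0_iff
  by blast

lemma (in comm_group) coprime_factorsI:
  assumes fin: "finite (carrier G)" and P: "subgroup P G"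
    and ord: "order G = card P * n" and cop: "coprime (card P) n"
  shows "\<exists>Q. coprime_factors G P Q \<and> card Q = n"
proof -
  obtain Q where "subgroup Q G" "card Q = n"
    using coprime_complement[OF P ord cop finite_subgroup_card_pos[OF fin P]] by blast
  then show ?thesis
    using assms comm_group_axioms by (auto simp: coprime_factors_def coprime_factors_axioms_def)
qed

lemma (in group) sylow_order_decomp:
  assumes fin: "finite (carrier G)" and p: "Factorial_Ring.prime (p::nat)"
  shows "\<exists>n. order G = p ^ multiplicity p (order G) * n \<and> \<not> p dvd n"
proof -
  have "order G \<noteq> 0" using fin order_gt_0_iff_finite by simp
  moreover have "\<not> is_unit p" using p not_prime_unit by blast
  ultimately obtain n where "order G = p ^ multiplicity p (order G) * n" "\<not> p dvd n"
    using multiplicity_decompose' by blast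
  then show ?thesis by blast
qed

lemma NCI2_sylow:
  fixes G :: "('a, 'b) monoid_scheme"
  assumes "comm_group G" "finite (carrier G)" "NCI2_group G" "sylow_subgroup p P G"
  shows "NCI2_group (G\<lparr>carrier := P\<rparr>)"
proof -
  interpret comm_group G by fact
  have p: "Factorial_Ring.prime p" "subgroup P G" "card P = p ^ multiplicity p (order G)"
    using assms(4) by (auto simp: sylow_subgroup_def)
  obtain n where n: "order G = card P * n" "\<not> p dvd n"
    using sylow_order_decomp[OF assms(2) p(1)] p(3) by metis
  have "coprime (card P) n"
    using n(2) p(1,3) by (simp add: prime_imp_coprime coprime_power_left_iff)
  then obtain Q where "coprime_factors G P Q" using coprime_factorsI[OF assms(2) p(2) n(1)] by blast
  then show ?thesis using coprime_factors.NCI2_factor assms(3) by blast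
qed

text \<open>Split off one Sylow subgroup \<open>P\<close> and use induction for its complement \<open>Q\<close>. The Sylow subgroups of
  \<open>Q\<close> are Sylow subgroups of \<open>G\<close>, except for the trivial one at the prime of \<open>P\<close>; that one is the Sylow
  subgroup of \<open>G\<close> at any prime larger than the order of \<open>G\<close>.\<close>

lemma sylow_NCI2:
  fixes G :: "('a, 'b) monoid_scheme"
  assumes "comm_group G" "finite (carrier G)"
    and "\<And>p P. sylow_subgroup p P G \<Longrightarrow> NCI2_group (G\<lparr>carrier := P\<rparr>)"
  shows "NCI2_group G"
  using assms
proof (induction "order G" arbitrary: G rule: less_induct)
  case less
  interpret comm_group G by fact
  note fin = less.prems(2) and syl = less.prems(3)
  have pos: "order G > 0" using fin order_gt_0_iff_finite by simp
  show ?case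
  proof (cases "order G = 1")
    case True
    \<comment> \<open>Any prime would do: the trivial group is its own Sylow subgroup at every prime.\<close>
    then have "sylow_subgroup 2 (carrier G) G"
      by (simp add: sylow_subgroup_def subgroup_self flip: order_def)
    from syl[OF this] show ?thesis by simp
  next
    case False
    then obtain p :: nat where p: "Factorial_Ring.prime p" "p dvd order G"
      using prime_factor_nat by blast
    obtain n where n: "order G = p ^ multiplicity p (order G) * n" "\<not> p dvd n"
      using sylow_order_decomp[OF fin p(1)] by blast
    obtain P where P: "subgroup P G" "card P = p ^ multiplicity p (order G)"
      using sylow_thm[OF p(1) group_axioms n(1) fin] by blast
    have sP: "sylow_subgroup p P G" using p P by (simp add: sylow_subgroup_def)
    have ord: "order G = card P * n" using n(1) P(2) by simp
    have "coprime (card P) n"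
      using n(2) p(1) P(2) by (simp add: prime_imp_coprime coprime_power_left_iff)
    then obtain Q where Q: "coprime_factors G P Q" "card Q = n"
      using coprime_factorsI[OF fin P(1) ord] by blast
    interpret F: coprime_factors G P Q by fact
    let ?Q = "G\<lparr>carrier := Q\<rparr>"
    have oQ: "order ?Q = n" using Q(2) by (simp add: order_def)
    have mp: "multiplicity p (order G) > 0"
      using p pos by (simp add: prime_multiplicity_gt_zero_iff)
    have npos: "n > 0" using pos ord by (cases n) auto
    have "card P > 1" unfolding P(2) using prime_gt_1_nat[OF p(1)] mp by (rule one_less_power)
    then have "n < order G" using ord npos by simp
    have "NCI2_group ?Q"
    proof (rule less.hyps)
      show "order ?Q < order G" using oQ \<open>n < order G\<close> by simp
      show "comm_group ?Q" by (rule coprime_factors.comm_group_A[OF F.swap])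
      show "finite (carrier ?Q)" using coprime_factors.finite_A[OF F.swap] by simp
      fix q R assume R: "sylow_subgroup q R ?Q"
      then have q: "Factorial_Ring.prime q" and subR: "subgroup R G" and cR: "card R = q ^ multiplicity q n"
        using incl_subgroup[OF F.subgroup_B] oQ by (auto simp: sylow_subgroup_def)
      have "\<exists>r. sylow_subgroup r R G"
      proof (cases "q = p")
        case True
        obtain r where r: "Factorial_Ring.prime r" "r > order G" using bigger_prime by blast
        then have "multiplicity r (order G) = 0"
          using pos by (intro not_dvd_imp_multiplicity_0) (auto dest: dvd_imp_le)
        moreover have "multiplicity q n = 0" using True n(2) by (simp add: not_dvd_imp_multiplicity_0)
        ultimately have "sylow_subgroup r R G" using r subR cR by (simp add: sylow_subgroup_def)
        then show ?thesis ..
      next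
        case False
        then have "multiplicity q (card P) = 0"
          using P(2) q p(1) by (simp add: multiplicity_distinct_prime_power)
        moreover have "card P \<noteq> 0" using \<open>card P > 1\<close> by simp
        ultimately have "multiplicity q (order G) = multiplicity q n"
          using q npos ord by (simp add: prime_elem_multiplicity_mult_distrib)
        then have "sylow_subgroup q R G" using q subR cR by (simp add: sylow_subgroup_def)
        then show ?thesis ..
      qed
      then show "NCI2_group (?Q\<lparr>carrier := R\<rparr>)" using syl by auto
    qed
    then show ?thesis using F.NCI2_product syl[OF sP] by blast
  qed
qed

theorem theorem1p1:
  fixes G :: "('a, 'b) monoid_scheme"
  assumes "comm_group G" and "finite (carrier G)"
  shows "NCI2_group G \<longleftrightarrow> (\<forall>p P. sylow_subgroup p P G \<longrightarrow> NCI2_group (G\<lparr>carrier := P\<rparr>))"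
  using NCI2_sylow[OF assms] sylow_NCI2[OF assms] by blast

end
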